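(* Let $W_4$ and $\widetilde W_4$ be planar $4$-webs on domains $D$ and $\widetilde D$ of the plane, and let $\Pi$ and $\widetilde\Pi$ be the projective structures on $D$ and $\widetilde D$ determined by $W_4$ and $\widetilde W_4$, respectively (that is, the unique projective structures for which all leaves of the web are geodesics). Then any diffeomorphism $D\to\widetilde D$ sending $W_4$ into $\widetilde W_4$ is a projective transformation of the corresponding projective structures, i.e. it maps $\Pi$ to $\widetilde\Pi$.
   Context: All objects are smooth. A planar $4$-web on a domain $D\subset\mathbb{R}^2$ is given by four one-dimensional foliations of $D$ that are pairwise transversal at every point. A diffeomorphism sends one web into another if it maps the leaves of each foliation of the first web to the leaves of a foliation of the second. Affine connections are torsion-free. Two affine connections $\nabla,\widetilde\nabla$ are projectively equivalent if there is a differential $1$-form $\rho$ with $\nabla_X(Y)-\widetilde\nabla_X(Y)=\rho(X)Y+\rho(Y)X$ for all vector fields $X,Y$. A projective structure is a class of projectively equivalent (torsion-free) affine connections; its geodesics are the unparametrized geodesics of any connection of the class. Every planar $4$-web determines a unique projective structure for which all its leaves are geodesics. A projective transformation between two projective structures is a diffeomorphism carrying the class of connections of the first to the class of connections of the second. *)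

theory Defs
  imports "HOL-Analysis.Analysis"
begin

text \<open>Smoothness is only meaningful here on open sets: all derivatives are taken at interior points.\<close>

primrec Ck_on :: "nat \<Rightarrow> 'a::euclidean_space set \<Rightarrow> ('a \<Rightarrow> 'b::real_normed_vector) \<Rightarrow> bool" where
  "Ck_on 0 S f \<longleftrightarrow> continuous_on S f"
| "Ck_on (Suc k) S f \<longleftrightarrow>
     (\<forall>x\<in>S. f differentiable (at x)) \<and> (\<forall>v. Ck_on k S (\<lambda>x. frechet_derivative f (at x) v))"

definition smooth_on :: "'a::euclidean_space set \<Rightarrow> ('a \<Rightarrow> 'b::real_normed_vector) \<Rightarrow> bool" where
  "smooth_on S f \<longleftrightarrow> (\<forall>k. Ck_on k S f)"

type_synonym plane = "real^2"

definition planar_domain :: "plane set \<Rightarrow> bool" where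
  "planar_domain D \<longleftrightarrow> open D \<and> connected D \<and> D \<noteq> {}"

definition diffeomorphism :: "plane set \<Rightarrow> plane set \<Rightarrow> (plane \<Rightarrow> plane) \<Rightarrow> bool" where
  "diffeomorphism U V \<phi> \<longleftrightarrow>
     bij_betw \<phi> U V \<and> smooth_on U \<phi> \<and> smooth_on V (inv_into U \<phi>)"


section \<open>Foliations and webs\<close>

text \<open>
  A one-dimensional foliation of \<open>D\<close> is given by its set of leaves: a decomposition of \<open>D\<close> such that
  near every point there are smooth coordinates in which the components of the leaves are the slices
  on which the second coordinate is constant.
  Leaves are connected in their intrinsic (leaf) topology, whence path-connectedness here.
  Connectedness in the subspace topology would be too weak: it does not exclude merging a closed
  leaf with a leaf that spirals towards it.
  In a chart the subspace topology is harmless: a leaf meets a chart in countably many plaques, so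
  its subspace components there are exactly these plaques, even if the leaf is not embedded.
\<close>

definition foliated_chart ::
  "plane set \<Rightarrow> plane set set \<Rightarrow> plane set \<Rightarrow> (plane \<Rightarrow> plane) \<Rightarrow> bool" where
  "foliated_chart D F U \<psi> \<longleftrightarrow>
     open U \<and> U \<subseteq> D \<and> open (\<psi> ` U) \<and> diffeomorphism U (\<psi> ` U) \<psi> \<and>
     (\<forall>L\<in>F. \<forall>C\<in>components (U \<inter> L). \<exists>c. C = {q\<in>U. \<psi> q $ 2 = c})"

definition foliation :: "plane set \<Rightarrow> plane set set \<Rightarrow> bool" where
  "foliation D F \<longleftrightarrow>
     partition_on D F \<and> (\<forall>L\<in>F. path_connected L) \<and>
     (\<forall>p\<in>D. \<exists>U \<psi>. p \<in> U \<and> foliated_chart D F U \<psi>)"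

definition velocity :: "(real \<Rightarrow> plane) \<Rightarrow> real \<Rightarrow> plane" where
  "velocity \<gamma> t = vector_derivative \<gamma> (at t)"

definition leaf_tangent :: "plane set \<Rightarrow> plane \<Rightarrow> plane set" where
  "leaf_tangent L p =
     {velocity \<gamma> 0 | \<gamma>. \<exists>\<epsilon>>0. smooth_on {-\<epsilon><..<\<epsilon>} \<gamma> \<and> \<gamma> ` {-\<epsilon><..<\<epsilon>} \<subseteq> L \<and> \<gamma> 0 = p}"

definition transversal :: "plane set set \<Rightarrow> plane set set \<Rightarrow> bool" where
  "transversal F G \<longleftrightarrow>
     (\<forall>L\<in>F. \<forall>M\<in>G. \<forall>p\<in>L \<inter> M. {u + v | u v. u \<in> leaf_tangent L p \<and> v \<in> leaf_tangent M p} = UNIV)"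

definition planar_4_web :: "plane set \<Rightarrow> plane set set set \<Rightarrow> bool" where
  "planar_4_web D W \<longleftrightarrow> card W = 4 \<and> (\<forall>F\<in>W. foliation D F) \<and> pairwise transversal W"

definition sends_web :: "(plane \<Rightarrow> plane) \<Rightarrow> plane set set set \<Rightarrow> plane set set set \<Rightarrow> bool" where
  "sends_web \<phi> W W' \<longleftrightarrow> (\<forall>F\<in>W. \<exists>F'\<in>W'. \<forall>L\<in>F. \<phi> ` L \<in> F')"


section \<open>Affine connections and projective structures\<close>

text \<open>
  A vector field on \<open>D\<close> is a function on the whole plane that is smooth on \<open>D\<close>; its values off \<open>D\<close>
  are irrelevant (the function-linearity and Leibniz rules, applied to functions that are constant
  on \<open>D\<close>, force the values of a connection on \<open>D\<close> to depend only on the fields on \<open>D\<close>).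
\<close>

abbreviation vector_field_on :: "plane set \<Rightarrow> (plane \<Rightarrow> plane) \<Rightarrow> bool" where
  "vector_field_on D X \<equiv> smooth_on D X"

type_synonym connection = "(plane \<Rightarrow> plane) \<Rightarrow> (plane \<Rightarrow> plane) \<Rightarrow> plane \<Rightarrow> plane"

definition lie_bracket :: "(plane \<Rightarrow> plane) \<Rightarrow> (plane \<Rightarrow> plane) \<Rightarrow> plane \<Rightarrow> plane" where
  "lie_bracket X Y p = frechet_derivative Y (at p) (X p) - frechet_derivative X (at p) (Y p)"

definition affine_connection :: "plane set \<Rightarrow> connection \<Rightarrow> bool" where
  "affine_connection D Nab \<longleftrightarrow>
     (\<forall>X Y. vector_field_on D X \<longrightarrow> vector_field_on D Y \<longrightarrow> vector_field_on D (Nab X Y)) \<and>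
     (\<forall>X Z Y. vector_field_on D X \<longrightarrow> vector_field_on D Z \<longrightarrow> vector_field_on D Y \<longrightarrow>
        (\<forall>p\<in>D. Nab (\<lambda>q. X q + Z q) Y p = Nab X Y p + Nab Z Y p)) \<and>
     (\<forall>(f::plane \<Rightarrow> real) X Y. smooth_on D f \<longrightarrow> vector_field_on D X \<longrightarrow> vector_field_on D Y \<longrightarrow>
        (\<forall>p\<in>D. Nab (\<lambda>q. f q *\<^sub>R X q) Y p = f p *\<^sub>R Nab X Y p)) \<and>
     (\<forall>X Y Z. vector_field_on D X \<longrightarrow> vector_field_on D Y \<longrightarrow> vector_field_on D Z \<longrightarrow>
        (\<forall>p\<in>D. Nab X (\<lambda>q. Y q + Z q) p = Nab X Y p + Nab X Z p)) \<and>
     (\<forall>(f::plane \<Rightarrow> real) X Y. smooth_on D f \<longrightarrow> vector_field_on D X \<longrightarrow> vector_field_on D Y \<longrightarrow>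
        (\<forall>p\<in>D. Nab X (\<lambda>q. f q *\<^sub>R Y q) p =
                 frechet_derivative f (at p) (X p) *\<^sub>R Y p + f p *\<^sub>R Nab X Y p)) \<and>
     (\<forall>X Y. vector_field_on D X \<longrightarrow> vector_field_on D Y \<longrightarrow>
        (\<forall>p\<in>D. Nab X Y p - Nab Y X p = lie_bracket X Y p))"

definition projectively_equivalent :: "plane set \<Rightarrow> connection \<Rightarrow> connection \<Rightarrow> bool" where
  "projectively_equivalent D Nab Nab' \<longleftrightarrow>
     (\<exists>\<rho> :: plane \<Rightarrow> (plane \<Rightarrow>\<^sub>L real). smooth_on D \<rho> \<and>
        (\<forall>X Y. vector_field_on D X \<longrightarrow> vector_field_on D Y \<longrightarrow>
           (\<forall>p\<in>D. Nab X Y p - Nab' X Y p =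
                   blinfun_apply (\<rho> p) (X p) *\<^sub>R Y p + blinfun_apply (\<rho> p) (Y p) *\<^sub>R X p)))"

definition projective_structure :: "plane set \<Rightarrow> connection set \<Rightarrow> bool" where
  "projective_structure D P \<longleftrightarrow>
     P \<in> {Nab. affine_connection D Nab} //
         {(Nab, Nab'). affine_connection D Nab \<and> affine_connection D Nab' \<and>
                       projectively_equivalent D Nab Nab'}"

text \<open>
  The covariant derivative of the velocity along a curve is
  \<open>\<gamma>'' + \<Gamma>(\<gamma>', \<gamma>')\<close>, where, in the Cartesian coordinates of the plane, the Christoffel form
  \<open>\<Gamma>(u, v)\<close> is the covariant derivative of the constant field \<open>v\<close> along the constant field \<open>u\<close>.
\<close>

definition acceleration :: "connection \<Rightarrow> (real \<Rightarrow> plane) \<Rightarrow> real \<Rightarrow> plane" where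
  "acceleration Nab \<gamma> t =
     vector_derivative (velocity \<gamma>) (at t) + Nab (\<lambda>_. velocity \<gamma> t) (\<lambda>_. velocity \<gamma> t) (\<gamma> t)"

definition regular_curve :: "real \<Rightarrow> real \<Rightarrow> (real \<Rightarrow> plane) \<Rightarrow> bool" where
  "regular_curve a b \<gamma> \<longleftrightarrow> smooth_on {a<..<b} \<gamma> \<and> (\<forall>t\<in>{a<..<b}. velocity \<gamma> t \<noteq> 0)"

definition unparametrized_geodesic :: "connection \<Rightarrow> real \<Rightarrow> real \<Rightarrow> (real \<Rightarrow> plane) \<Rightarrow> bool" where
  "unparametrized_geodesic Nab a b \<gamma> \<longleftrightarrow>
     regular_curve a b \<gamma> \<and> (\<forall>t\<in>{a<..<b}. \<exists>c. acceleration Nab \<gamma> t = c *\<^sub>R velocity \<gamma> t)"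

definition leaf_geodesic :: "connection set \<Rightarrow> plane set \<Rightarrow> bool" where
  "leaf_geodesic P L \<longleftrightarrow>
     (\<forall>Nab\<in>P. \<forall>a b \<gamma>. regular_curve a b \<gamma> \<and> \<gamma> ` {a<..<b} \<subseteq> L \<longrightarrow> unparametrized_geodesic Nab a b \<gamma>)"

text \<open>
  A relation rather than a function of the web: it singles out at most one \<open>P\<close>, but this
  uniqueness is not part of the definition.
\<close>

definition web_projective_structure ::
  "plane set \<Rightarrow> plane set set set \<Rightarrow> connection set \<Rightarrow> bool" where
  "web_projective_structure D W P \<longleftrightarrow>
     projective_structure D P \<and> (\<forall>F\<in>W. \<forall>L\<in>F. leaf_geodesic P L)"


section \<open>Projective transformations\<close>

definition push_field :: "plane set \<Rightarrow> (plane \<Rightarrow> plane) \<Rightarrow> (plane \<Rightarrow> plane) \<Rightarrow> plane \<Rightarrow> plane" where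
  "push_field D \<phi> X q =
     (let p = inv_into D \<phi> q in frechet_derivative \<phi> (at p) (X p))"

definition carries_connection ::
  "plane set \<Rightarrow> plane set \<Rightarrow> (plane \<Rightarrow> plane) \<Rightarrow> connection \<Rightarrow> connection \<Rightarrow> bool" where
  "carries_connection D D' \<phi> Nab Nab' \<longleftrightarrow>
     (\<forall>X Y. vector_field_on D X \<longrightarrow> vector_field_on D Y \<longrightarrow>
        (\<forall>q\<in>D'. Nab' (push_field D \<phi> X) (push_field D \<phi> Y) q = push_field D \<phi> (Nab X Y) q))"

text \<open>
  Every connection in \<open>P\<close> contributes all its push-forwards: as a function, a push-forward is
  determined only up to its values off \<open>D'\<close>.
\<close>

definition push_structure ::
  "plane set \<Rightarrow> plane set \<Rightarrow> (plane \<Rightarrow> plane) \<Rightarrow> connection set \<Rightarrow> connection set" where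
  "push_structure D D' \<phi> P =
     {Nab'. affine_connection D' Nab' \<and> (\<exists>Nab\<in>P. carries_connection D D' \<phi> Nab Nab')}"

definition projective_transformation ::
  "plane set \<Rightarrow> connection set \<Rightarrow> plane set \<Rightarrow> connection set \<Rightarrow> (plane \<Rightarrow> plane) \<Rightarrow> bool" where
  "projective_transformation D P D' P' \<phi> \<longleftrightarrow>
     diffeomorphism D D' \<phi> \<and> push_structure D D' \<phi> P = P'"

end

theory Submission
  imports Defs
begin

text \<open>
  Two connections of the plane differ by a symmetric bilinear form \<open>S\<close>, and they are projectively
  equivalent iff \<open>S(u, u)\<close> is always a multiple of \<open>u\<close>. This says that the binary cubic
  \<open>det (S(u, u), u)\<close> vanishes identically, for which four pairwise independent zeros suffice; any two
  connections that have the leaves of a 4-web as geodesics share the four web directions as zeros.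
  A diffeomorphism transports connections together with accelerations of curves, so the transported
  connection and any connection of the target structure have the images of the leaves as common
  geodesics. That the transported connection is torsion-free is the symmetry of second derivatives.
\<close>

section \<open>Calculus of smooth maps\<close>

text \<open>A connection is an operator on vector fields, so it must first be reduced to its
  Christoffel form. No cut-off functions are involved, because the constant fields
  \<open>axis 1 1\<close> and \<open>axis 2 1\<close> frame the whole plane. Equality of the
  structures means two inclusions: a push-forward of a member of \<open>P\<close> is compared with
  \<open>P'\<close> on \<open>D'\<close>, whereas a member of \<open>P'\<close> needs a preimage,
  which \<open>pull_connection\<close> supplies. In both cases the directions come from leaves of
  \<open>W\<close>, chosen on \<open>D\<close> and moved to \<open>D'\<close> by the derivative of
  \<open>\<phi>\<close>. They may be chosen at each point separately, without any regularity, since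
  the form \<open>\<rho>\<close> is read off from the Christoffel forms alone and inherits their
  smoothness. The last obstacle is that \<open>leaf_tangent\<close> is a bare set of velocities and
  transversality a statement about sums of such sets. A foliated chart confines each set to a line;
  the sums can then fill the plane only if every foliation has a nonzero velocity and velocities of
  different foliations are independent.\<close>

lemma frechet_derivative_has_derivative:
  assumes "(f has_derivative f') (at x)"
  shows "frechet_derivative f (at x) = f'"
  using frechet_derivative_at[OF assms] by simp

text \<open>Openness makes agreement on \<open>S\<close> an agreement near each of its points, so it
  passes to derivatives of every order.\<close>

lemma Ck_on_cong:
  assumes "open S" "\<And>x. x \<in> S \<Longrightarrow> f x = g x" "Ck_on k S f"
  shows "Ck_on k S g"
  using assms(2,3)
proof (induction k arbitrary: f g)
  case 0
  then show ?case by (simp cong: continuous_on_cong)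
next
  case (Suc k)
  have *: "(g has_derivative frechet_derivative f (at x)) (at x)" if "x \<in> S" for x
  proof (rule has_derivative_transform_within_open[OF _ assms(1) that Suc.prems(1)])
    show "(f has_derivative frechet_derivative f (at x)) (at x)"
      by (rule iffD1[OF frechet_derivative_works]) (use Suc.prems(2) that in auto)
  qed
  have eq: "frechet_derivative f (at x) = frechet_derivative g (at x)" if "x \<in> S" for x
    using frechet_derivative_has_derivative[OF *[OF that]] by simp
  have "Ck_on k S (\<lambda>x. frechet_derivative g (at x) v)" for v
    by (rule Suc.IH[of "\<lambda>x. frechet_derivative f (at x) v"]) (use Suc.prems eq in auto)
  then show ?case using * by (auto simp: differentiable_def)
qed

lemma Ck_on_subset: "Ck_on k S f \<Longrightarrow> T \<subseteq> S \<Longrightarrow> Ck_on k T f"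
  by (induction k arbitrary: f) (auto intro: continuous_on_subset)

lemma Ck_on_SucD: "Ck_on (Suc k) S f \<Longrightarrow> Ck_on k S f"
proof (induction k arbitrary: f)
  case 0
  then show ?case
    by (auto intro!: continuous_at_imp_continuous_on differentiable_imp_continuous_within)
next
  case (Suc k)
  have "Ck_on k S (\<lambda>x. frechet_derivative f (at x) v)" for v
    by (rule Suc.IH) (use Suc.prems in auto)
  then show ?case using Suc.prems by (metis Ck_on.simps(2))
qed

lemma Ck_on_const: "Ck_on k S (\<lambda>_. c)"
  by (induction k arbitrary: c) auto

text \<open>Lets an explicit formula \<open>f'\<close> stand in for the chosen
  \<open>frechet_derivative\<close>; the closure properties below all go through this rule.\<close>

lemma Ck_on_SucI:
  assumes "open S" "\<And>x. x \<in> S \<Longrightarrow> (f has_derivative f' x) (at x)"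
    "\<And>v. Ck_on k S (\<lambda>x. f' x v)"
  shows "Ck_on (Suc k) S f"
  using assms(2) frechet_derivative_has_derivative[OF assms(2)]
  by (auto simp: differentiable_def intro!: Ck_on_cong[OF assms(1) _ assms(3)])

lemma Ck_on_Suc_has_derivative:
  assumes "Ck_on (Suc k) S f" "x \<in> S"
  shows "(f has_derivative frechet_derivative f (at x)) (at x)"
  by (rule iffD1[OF frechet_derivative_works]) (use assms in auto)

lemma Ck_on_add:
  assumes "open S"
  shows "Ck_on k S f \<Longrightarrow> Ck_on k S g \<Longrightarrow> Ck_on k S (\<lambda>x. f x + g x)"
proof (induction k arbitrary: f g)
  case (Suc k)
  show ?case
    by (rule Ck_on_SucI[OF assms has_derivative_add[OF Ck_on_Suc_has_derivative[OF Suc.prems(1)]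
        Ck_on_Suc_has_derivative[OF Suc.prems(2)]]]) (use Suc in auto)
qed (auto intro!: continuous_on_add continuous_on_scaleR)

lemma Ck_on_scaleR:
  fixes f :: "_ \<Rightarrow> real"
  assumes "open S"
  shows "Ck_on k S f \<Longrightarrow> Ck_on k S g \<Longrightarrow> Ck_on k S (\<lambda>x. f x *\<^sub>R g x)"
proof (induction k arbitrary: f g)
  case (Suc k)
  show ?case
    by (rule Ck_on_SucI[OF assms has_derivative_scaleR[OF Ck_on_Suc_has_derivative[OF Suc.prems(1)]
        Ck_on_Suc_has_derivative[OF Suc.prems(2)]]])
       (use Suc.prems Ck_on_SucD[OF Suc.prems(1)] Ck_on_SucD[OF Suc.prems(2)] in
         \<open>auto intro!: Ck_on_add[OF assms] Suc.IH\<close>)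
qed (auto intro!: continuous_on_add continuous_on_scaleR)

lemma Ck_on_bounded_linear:
  assumes "open S" "bounded_linear h"
  shows "Ck_on k S f \<Longrightarrow> Ck_on k S (\<lambda>x. h (f x))"
proof (induction k arbitrary: f)
  case 0
  then show ?case
    using bounded_linear.continuous_on[OF assms(2)] by auto
next
  case (Suc k)
  show ?case
    by (rule Ck_on_SucI[OF assms(1) bounded_linear.has_derivative[OF assms(2) Ck_on_Suc_has_derivative[OF Suc.prems]]])
      (use Suc in auto)
qed

lemma Ck_on_sum:
  assumes "open S"
  shows "(\<And>i. i \<in> I \<Longrightarrow> Ck_on k S (f i)) \<Longrightarrow> Ck_on k S (\<lambda>x. \<Sum>i\<in>I. f i x)"
  by (induction I rule: infinite_finite_induct) (auto intro: Ck_on_const Ck_on_add[OF assms])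

text \<open>\<open>Ck_on\<close> controls derivatives in fixed directions only. This expansion
  trades a varying direction for scalar coefficients and fixed basis directions.\<close>

lemma frechet_derivative_coords:
  fixes g :: "'a::euclidean_space \<Rightarrow> 'b::real_normed_vector"
  assumes "g differentiable (at x)"
  shows "frechet_derivative g (at x) v = (\<Sum>b\<in>Basis. (v \<bullet> b) *\<^sub>R frechet_derivative g (at x) b)"
proof -
  interpret linear "frechet_derivative g (at x)" by (rule linear_frechet_derivative[OF assms])
  have "frechet_derivative g (at x) v = frechet_derivative g (at x) (\<Sum>b\<in>Basis. (v \<bullet> b) *\<^sub>R b)"
    by (simp add: euclidean_representation)
  also have "\<dots> = (\<Sum>b\<in>Basis. (v \<bullet> b) *\<^sub>R frechet_derivative g (at x) b)"
    by (simp add: sum scale)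
  finally show ?thesis .
qed

text \<open>In the chain rule the derivative of \<open>g\<close> is applied to a direction that
  varies with \<open>x\<close>. Expanded over the basis it becomes a sum of products whose factors
  are covered by the induction hypothesis for the partial derivatives of \<open>g\<close>, with
  \<open>f\<close> fixed.\<close>

lemma Ck_on_compose:
  fixes f :: "'a::euclidean_space \<Rightarrow> 'b::euclidean_space" and g :: "'b \<Rightarrow> 'c::real_normed_vector"
  assumes "open S" "f ` S \<subseteq> T"
  shows "Ck_on k S f \<Longrightarrow> Ck_on k T g \<Longrightarrow> Ck_on k S (\<lambda>x. g (f x))"
proof (induction k arbitrary: g)
  case 0
  then show ?case using continuous_on_compose2[of T g S f] assms by auto
next
  case (Suc k)
  note fd = Ck_on_Suc_has_derivative[OF Suc.prems(1)]
  note gd = Ck_on_Suc_has_derivative[OF Suc.prems(2)]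
  have "((\<lambda>x. g (f x)) has_derivative
      (\<lambda>v. \<Sum>b\<in>Basis. (frechet_derivative f (at x) v \<bullet> b) *\<^sub>R frechet_derivative g (at (f x)) b)) (at x)"
    if "x \<in> S" for x
  proof -
    have fx: "f x \<in> T" using that assms(2) by auto
    then have "g differentiable (at (f x))" using Suc.prems(2) by auto
    from frechet_derivative_coords[OF this, symmetric] has_derivative_compose[OF fd[OF that] gd[OF fx]]
    show ?thesis by simp
  qed
  then show ?case
  proof (rule Ck_on_SucI[OF assms(1)])
    fix v
    show "Ck_on k S (\<lambda>x. \<Sum>b\<in>Basis. (frechet_derivative f (at x) v \<bullet> b) *\<^sub>R frechet_derivative g (at (f x)) b)"
      using Suc.prems
      by (intro Ck_on_sum[OF assms(1)] Ck_on_scaleR[OF assms(1)] Suc.IH Ck_on_SucD[of k S f]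
          Ck_on_bounded_linear[OF assms(1) bounded_linear_inner_left]) auto
  qed
qed

section \<open>Smooth maps: all orders at once\<close>

lemma smooth_on_cong: "open S \<Longrightarrow> (\<And>x. x \<in> S \<Longrightarrow> f x = g x) \<Longrightarrow> smooth_on S f \<Longrightarrow> smooth_on S g"
  unfolding smooth_on_def using Ck_on_cong by blast

lemma smooth_on_subset: "smooth_on S f \<Longrightarrow> T \<subseteq> S \<Longrightarrow> smooth_on T f"
  unfolding smooth_on_def using Ck_on_subset by blast

lemma smooth_on_const: "smooth_on S (\<lambda>_. c)"
  unfolding smooth_on_def using Ck_on_const by blast

lemma smooth_on_add: "open S \<Longrightarrow> smooth_on S f \<Longrightarrow> smooth_on S g \<Longrightarrow> smooth_on S (\<lambda>x. f x + g x)"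
  unfolding smooth_on_def using Ck_on_add by blast

lemma smooth_on_scaleR:
  "open S \<Longrightarrow> smooth_on S f \<Longrightarrow> smooth_on S g \<Longrightarrow> smooth_on S (\<lambda>x. f x *\<^sub>R g x)" for f :: "_ \<Rightarrow> real"
  unfolding smooth_on_def using Ck_on_scaleR by blast

lemma smooth_on_bounded_linear:
  "open S \<Longrightarrow> bounded_linear h \<Longrightarrow> smooth_on S f \<Longrightarrow> smooth_on S (\<lambda>x. h (f x))"
  unfolding smooth_on_def using Ck_on_bounded_linear by blast

lemma smooth_on_diff: "open S \<Longrightarrow> smooth_on S f \<Longrightarrow> smooth_on S g \<Longrightarrow> smooth_on S (\<lambda>x. f x - g x)"
  using smooth_on_add[of S f "\<lambda>x. - g x"] smooth_on_bounded_linear[OF _ bounded_linear_minus[OF bounded_linear_ident], of S g]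
  by simp

lemma smooth_on_sum:
  "open S \<Longrightarrow> (\<And>i. i \<in> I \<Longrightarrow> smooth_on S (f i)) \<Longrightarrow> smooth_on S (\<lambda>x. \<Sum>i\<in>I. f i x)"
  unfolding smooth_on_def by (auto intro: Ck_on_sum)

lemma smooth_on_compose:
  fixes f :: "'a::euclidean_space \<Rightarrow> 'b::euclidean_space" and g :: "'b \<Rightarrow> 'c::real_normed_vector"
  assumes "open S" "f ` S \<subseteq> T" "smooth_on S f" "smooth_on T g"
  shows "smooth_on S (\<lambda>x. g (f x))"
  using Ck_on_compose[OF assms(1,2)] assms(3,4) unfolding smooth_on_def by blast

lemma smooth_on_differentiable: "smooth_on S f \<Longrightarrow> x \<in> S \<Longrightarrow> f differentiable (at x)"
  unfolding smooth_on_def by (metis Ck_on.simps(2))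

lemma smooth_on_has_derivative:
  "smooth_on S f \<Longrightarrow> x \<in> S \<Longrightarrow> (f has_derivative frechet_derivative f (at x)) (at x)"
  using smooth_on_differentiable frechet_derivative_works by blast

lemma smooth_on_frechet_derivative: "smooth_on S f \<Longrightarrow> smooth_on S (\<lambda>x. frechet_derivative f (at x) v)"
  unfolding smooth_on_def by (metis Ck_on.simps(2))

lemma smooth_on_continuous_on: "smooth_on S f \<Longrightarrow> continuous_on S f"
  unfolding smooth_on_def by (metis Ck_on.simps(1))

lemma smooth_on_frechet_apply:
  fixes f :: "'a::euclidean_space \<Rightarrow> 'b::euclidean_space" and g :: "'b \<Rightarrow> 'c::real_normed_vector"
  assumes "open S" "f ` S \<subseteq> T" "smooth_on S f" "smooth_on T g" "smooth_on S V"
  shows "smooth_on S (\<lambda>x. frechet_derivative g (at (f x)) (V x))"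
proof (rule smooth_on_cong[OF assms(1)])
  show "smooth_on S (\<lambda>x. \<Sum>b\<in>Basis. (V x \<bullet> b) *\<^sub>R frechet_derivative g (at (f x)) b)"
  proof (intro smooth_on_sum smooth_on_scaleR assms(1))
    fix b :: 'b
    show "smooth_on S (\<lambda>x. V x \<bullet> b)"
      by (rule smooth_on_bounded_linear[OF assms(1) bounded_linear_inner_left assms(5)])
    show "smooth_on S (\<lambda>x. frechet_derivative g (at (f x)) b)"
      by (rule smooth_on_compose[OF assms(1-3) smooth_on_frechet_derivative[OF assms(4)]])
  qed
  show "(\<Sum>b\<in>Basis. (V x \<bullet> b) *\<^sub>R frechet_derivative g (at (f x)) b) = frechet_derivative g (at (f x)) (V x)"
    if "x \<in> S" for x
  proof -
    have "f x \<in> T" using that assms(2) by auto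
    then show ?thesis
      using frechet_derivative_coords[OF smooth_on_differentiable[OF assms(4)], symmetric] by simp
  qed
qed

lemma linear_frechet_smooth: "smooth_on S f \<Longrightarrow> x \<in> S \<Longrightarrow> linear (frechet_derivative f (at x))"
  using smooth_on_differentiable linear_frechet_derivative by blast

text \<open>Product rule with moving base point and moving direction: the first term differentiates
  the direction, the second freezes it at \<open>V x\<close> and gives the second derivative of
  \<open>g\<close>. It yields both the second velocity of an image curve and the derivative of a
  pushed field.\<close>

lemma has_derivative_frechet_apply:
  fixes f :: "'a::euclidean_space \<Rightarrow> 'b::euclidean_space" and g :: "'b \<Rightarrow> 'c::real_normed_vector"
  assumes "open S" "x \<in> S" "open T" "f ` S \<subseteq> T" "smooth_on T g"
    and f: "(f has_derivative f') (at x)" and V: "(V has_derivative V') (at x)"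
  shows "((\<lambda>y. frechet_derivative g (at (f y)) (V y)) has_derivative
     (\<lambda>h. frechet_derivative g (at (f x)) (V' h) +
          frechet_derivative (\<lambda>z. frechet_derivative g (at z) (V x)) (at (f x)) (f' h))) (at x)"
proof (rule has_derivative_transform_within_open[OF _ assms(1,2)])
  have in_T: "f y \<in> T" if "y \<in> S" for y using that assms(4) by auto
  note gdiff = smooth_on_differentiable[OF assms(5) in_T]
  note g2 = smooth_on_has_derivative[OF smooth_on_frechet_derivative[OF assms(5)] in_T[OF assms(2)]]
  have lin: "(\<Sum>b\<in>Basis. (u \<bullet> b) *\<^sub>R frechet_derivative g (at (f x)) b) = frechet_derivative g (at (f x)) u" for u
    by (rule frechet_derivative_coords[OF gdiff[OF assms(2)], symmetric])
  have "((\<lambda>z. \<Sum>b\<in>Basis. (V x \<bullet> b) *\<^sub>R frechet_derivative g (at z) b) has_derivative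
      (\<lambda>h. \<Sum>b\<in>Basis. (V x \<bullet> b) *\<^sub>R frechet_derivative (\<lambda>z. frechet_derivative g (at z) b) (at (f x)) h)) (at (f x))"
    by (rule has_derivative_sum, rule has_derivative_scaleR_right, rule g2)
  moreover have "((\<lambda>z. \<Sum>b\<in>Basis. (V x \<bullet> b) *\<^sub>R frechet_derivative g (at z) b) has_derivative
      (\<lambda>h. frechet_derivative (\<lambda>z. frechet_derivative g (at z) (V x)) (at (f x)) h)) (at (f x))"
    by (rule has_derivative_transform_within_open[OF g2 assms(3) in_T[OF assms(2)]])
      (rule frechet_derivative_coords[OF smooth_on_differentiable[OF assms(5)]])
  ultimately have second: "(\<Sum>b\<in>Basis. (V x \<bullet> b) *\<^sub>R frechet_derivative (\<lambda>z. frechet_derivative g (at z) b) (at (f x)) h)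
      = frechet_derivative (\<lambda>z. frechet_derivative g (at z) (V x)) (at (f x)) h" for h
    by (rule fun_cong[OF has_derivative_unique])
  have "((\<lambda>y. \<Sum>b\<in>Basis. (V y \<bullet> b) *\<^sub>R frechet_derivative g (at (f y)) b) has_derivative
      (\<lambda>h. \<Sum>b\<in>Basis. (V x \<bullet> b) *\<^sub>R frechet_derivative (\<lambda>z. frechet_derivative g (at z) b) (at (f x)) (f' h)
         + (V' h \<bullet> b) *\<^sub>R frechet_derivative g (at (f x)) b)) (at x)"
    by (rule has_derivative_sum, rule has_derivative_scaleR,
        rule bounded_linear.has_derivative[OF bounded_linear_inner_left V],
        rule has_derivative_compose[OF f g2])
  then show "((\<lambda>y. \<Sum>b\<in>Basis. (V y \<bullet> b) *\<^sub>R frechet_derivative g (at (f y)) b) has_derivative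
     (\<lambda>h. frechet_derivative g (at (f x)) (V' h) +
          frechet_derivative (\<lambda>z. frechet_derivative g (at z) (V x)) (at (f x)) (f' h))) (at x)"
    by (simp only: sum.distrib lin second add.commute)
  show "(\<Sum>b\<in>Basis. (V y \<bullet> b) *\<^sub>R frechet_derivative g (at (f y)) b) = frechet_derivative g (at (f y)) (V y)"
    if "y \<in> S" for y
    using frechet_derivative_coords[OF gdiff[OF that], symmetric] .
qed

section \<open>Symmetry of second derivatives\<close>

lemma has_real_derivative_along_line:
  fixes g :: "'a::euclidean_space \<Rightarrow> real"
  assumes "smooth_on S g" "y + t *\<^sub>R v \<in> S"
  shows "((\<lambda>t. g (y + t *\<^sub>R v)) has_real_derivative frechet_derivative g (at (y + t *\<^sub>R v)) v) (at t)"
proof -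
  have "((\<lambda>t. y + t *\<^sub>R v) has_derivative (\<lambda>h. h *\<^sub>R v)) (at t)"
    by (auto intro!: derivative_eq_intros)
  from has_derivative_compose[OF this smooth_on_has_derivative[OF assms]]
  have "((\<lambda>t. g (y + t *\<^sub>R v)) has_derivative
      (\<lambda>h. frechet_derivative g (at (y + t *\<^sub>R v)) (h *\<^sub>R v))) (at t)" .
  then show ?thesis
    using linear_cmul[OF linear_frechet_smooth[OF assms]]
    by (simp add: has_field_derivative_def mult_commute_abs)
qed

text \<open>Two applications of the mean value theorem, along \<open>u\<close> and then along
  \<open>v\<close>. The ball contains the whole parallelogram spanned by
  \<open>h *\<^sub>R u\<close> and \<open>h *\<^sub>R v\<close>.\<close>

lemma mixed_difference_mvt:
  fixes f :: "'a::euclidean_space \<Rightarrow> real"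
  assumes f: "smooth_on S f" and h: "0 < h"
    and sub: "cball x (h * (norm u + norm v)) \<subseteq> S"
  shows "\<exists>y\<in>cball x (h * (norm u + norm v)).
    f (x + h *\<^sub>R u + h *\<^sub>R v) - f (x + h *\<^sub>R u) - f (x + h *\<^sub>R v) + f x
      = h * h * frechet_derivative (\<lambda>z. frechet_derivative f (at z) u) (at y) v"
proof -
  have mem: "x + s *\<^sub>R u + t *\<^sub>R v \<in> cball x (h * (norm u + norm v))"
    if "0 \<le> s" "s \<le> h" "0 \<le> t" "t \<le> h" for s t
  proof -
    have "dist x (x + s *\<^sub>R u + t *\<^sub>R v) = norm (s *\<^sub>R u + t *\<^sub>R v)"
      using dist_add_cancel[of x 0 "s *\<^sub>R u + t *\<^sub>R v"] by (simp add: add.assoc)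
    also have "\<dots> \<le> s * norm u + t * norm v"
      using norm_triangle_ineq[of "s *\<^sub>R u" "t *\<^sub>R v"] that by simp
    also have "\<dots> \<le> h * norm u + h * norm v"
      using that by (intro add_mono mult_right_mono) auto
    finally show ?thesis by (simp add: algebra_simps)
  qed
  have inS: "x + s *\<^sub>R u + t *\<^sub>R v \<in> S" if "0 \<le> s" "s \<le> h" "0 \<le> t" "t \<le> h" for s t
    using mem[OF that] sub by blast
  \<comment> \<open>The increment of \<open>G\<close> over the interval from 0 to \<open>h\<close>
    is the second difference of \<open>f\<close> over the parallelogram.\<close>
  define G where "G s = f (x + h *\<^sub>R v + s *\<^sub>R u) - f (x + s *\<^sub>R u)" for s
  have "(G has_real_derivative (frechet_derivative f (at (x + h *\<^sub>R v + s *\<^sub>R u)) u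
      - frechet_derivative f (at (x + s *\<^sub>R u)) u)) (at s)" if "0 \<le> s" "s \<le> h" for s
    unfolding G_def
    using inS[of s h] inS[of s 0] that h
    by (intro DERIV_diff has_real_derivative_along_line[OF f]) (auto simp: algebra_simps)
  from MVT2[OF h this] obtain s where s: "0 < s" "s < h" and
    Gs: "G h - G 0 = h * (frechet_derivative f (at (x + h *\<^sub>R v + s *\<^sub>R u)) u
      - frechet_derivative f (at (x + s *\<^sub>R u)) u)" by auto
  define H where "H t = frechet_derivative f (at (x + s *\<^sub>R u + t *\<^sub>R v)) u" for t
  have "(H has_real_derivative frechet_derivative (\<lambda>z. frechet_derivative f (at z) u) (at (x + s *\<^sub>R u + t *\<^sub>R v)) v) (at t)"
    if "0 \<le> t" "t \<le> h" for t
    unfolding H_def using inS[of s t] s that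
    by (intro has_real_derivative_along_line[OF smooth_on_frechet_derivative[OF f]]) auto
  from MVT2[OF h this] obtain t where t: "0 < t" "t < h" and
    Ht: "H h - H 0 = h * frechet_derivative (\<lambda>z. frechet_derivative f (at z) u) (at (x + s *\<^sub>R u + t *\<^sub>R v)) v"
    by auto
  have "G h - G 0 = h * (H h - H 0)"
    unfolding Gs H_def by (simp add: algebra_simps)
  with Ht have "G h - G 0 = h * h * frechet_derivative (\<lambda>z. frechet_derivative f (at z) u) (at (x + s *\<^sub>R u + t *\<^sub>R v)) v"
    by (simp add: algebra_simps)
  then show ?thesis
    using mem[of s t] s t by (intro bexI[of _ "x + s *\<^sub>R u + t *\<^sub>R v"]) (auto simp: G_def algebra_simps)
qed

text \<open>The second difference is symmetric in \<open>u\<close> and \<open>v\<close>, so the two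
  mixed derivatives take a common value at points arbitrarily near \<open>x\<close>; continuity does
  the rest.\<close>

lemma second_derivative_symmetric_real:
  fixes f :: "'a::euclidean_space \<Rightarrow> real"
  assumes "open S" and f: "smooth_on S f" and x: "x \<in> S"
  shows "frechet_derivative (\<lambda>z. frechet_derivative f (at z) u) (at x) v
       = frechet_derivative (\<lambda>z. frechet_derivative f (at z) v) (at x) u"
proof (rule ccontr)
  define A where "A y = frechet_derivative (\<lambda>z. frechet_derivative f (at z) u) (at y) v" for y
  define B where "B y = frechet_derivative (\<lambda>z. frechet_derivative f (at z) v) (at y) u" for y
  define e where "e = \<bar>A x - B x\<bar> / 2"
  assume "\<not> ?thesis"
  then have e: "e > 0" by (simp add: e_def A_def B_def)
  have cont: "continuous (at x) A" "continuous (at x) B"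
    using smooth_on_continuous_on[OF smooth_on_frechet_derivative[OF smooth_on_frechet_derivative[OF f]]]
      continuous_on_eq_continuous_at[OF \<open>open S\<close>] x unfolding A_def B_def by blast+
  obtain d1 where d1: "d1 > 0" "\<And>y. dist y x < d1 \<Longrightarrow> dist (A y) (A x) < e"
    using cont(1) e unfolding continuous_at_eps_delta by metis
  obtain d2 where d2: "d2 > 0" "\<And>y. dist y x < d2 \<Longrightarrow> dist (B y) (B x) < e"
    using cont(2) e unfolding continuous_at_eps_delta by metis
  obtain d3 where d3: "d3 > 0" "ball x d3 \<subseteq> S"
    using \<open>open S\<close> x open_contains_ball by blast
  define d where "d = min d1 (min d2 d3)"
  have d: "d > 0" "d \<le> d1" "d \<le> d2" "d \<le> d3" using d1(1) d2(1) d3(1) by (auto simp: d_def)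
  \<comment> \<open>The summand 1 avoids division by zero when both vectors vanish and keeps the
    parallelogram strictly within distance \<open>d\<close>.\<close>
  define h where "h = d / (norm u + norm v + 1)"
  have "norm u + norm v + 1 > 0" by (simp add: add_nonneg_pos)
  then have h: "h > 0" "h * (norm u + norm v) < d"
    using d(1) by (auto simp: h_def field_simps)
  have sub: "cball x (h * (norm u + norm v)) \<subseteq> S"
    using h(2) d(4) d3(2) by (auto simp: subset_eq)
  then have sub': "cball x (h * (norm v + norm u)) \<subseteq> S" by (simp add: add.commute)
  obtain y where y: "y \<in> cball x (h * (norm u + norm v))"
    "f (x + h *\<^sub>R u + h *\<^sub>R v) - f (x + h *\<^sub>R u) - f (x + h *\<^sub>R v) + f x = h * h * A y"
    using mixed_difference_mvt[OF f h(1) sub] unfolding A_def by blast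
  obtain z where z: "z \<in> cball x (h * (norm v + norm u))"
    "f (x + h *\<^sub>R v + h *\<^sub>R u) - f (x + h *\<^sub>R v) - f (x + h *\<^sub>R u) + f x = h * h * B z"
    using mixed_difference_mvt[OF f h(1) sub'] unfolding B_def by blast
  have "h * h * A y = h * h * B z"
    using y(2) z(2) by (simp add: algebra_simps)
  then have "A y = B z" using h(1) by simp
  moreover have "dist (A y) (A x) < e"
    by (rule d1(2)) (use y(1) h(2) d(2) in \<open>simp add: dist_commute\<close>)
  moreover have "dist (B z) (B x) < e"
    by (rule d2(2)) (use z(1) h(2) d(3) in \<open>simp add: dist_commute add.commute\<close>)
  moreover have "\<bar>A x - B x\<bar> \<le> \<bar>A y - A x\<bar> + \<bar>B z - B x\<bar>"
    using \<open>A y = B z\<close> by arith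
  ultimately show False unfolding e_def dist_real_def by simp
qed

text \<open>Reduced to components, since the mean value argument needs real values.\<close>

lemma second_derivative_symmetric:
  fixes f :: "'a::euclidean_space \<Rightarrow> 'b::euclidean_space"
  assumes S: "open S" and f: "smooth_on S f" and x: "x \<in> S"
  shows "frechet_derivative (\<lambda>z. frechet_derivative f (at z) u) (at x) v
       = frechet_derivative (\<lambda>z. frechet_derivative f (at z) v) (at x) u"
proof (rule euclidean_eqI)
  fix b :: 'b assume "b \<in> Basis"
  note bl = bounded_linear_inner_left[of b]
  have sm: "smooth_on S (\<lambda>z. f z \<bullet> b)" by (rule smooth_on_bounded_linear[OF S bl f])
  have first: "frechet_derivative (\<lambda>z. f z \<bullet> b) (at y) w = frechet_derivative f (at y) w \<bullet> b" if "y \<in> S" for y w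
    using frechet_derivative_has_derivative[OF bounded_linear.has_derivative[OF bl smooth_on_has_derivative[OF f that]]]
    by simp
  have second: "frechet_derivative (\<lambda>z. frechet_derivative (\<lambda>z. f z \<bullet> b) (at z) w) (at x) w'
      = frechet_derivative (\<lambda>z. frechet_derivative f (at z) w) (at x) w' \<bullet> b" for w w'
  proof -
    have "((\<lambda>z. frechet_derivative f (at z) w \<bullet> b) has_derivative
        (\<lambda>h. frechet_derivative (\<lambda>z. frechet_derivative f (at z) w) (at x) h \<bullet> b)) (at x)"
      by (rule bounded_linear.has_derivative[OF bl smooth_on_has_derivative[OF smooth_on_frechet_derivative[OF f] x]])
    from has_derivative_transform_within_open[OF this S x first[symmetric]]
    show ?thesis by (simp add: frechet_derivative_has_derivative)
  qed
  show "frechet_derivative (\<lambda>z. frechet_derivative f (at z) u) (at x) v \<bullet> b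
      = frechet_derivative (\<lambda>z. frechet_derivative f (at z) v) (at x) u \<bullet> b"
    using second_derivative_symmetric_real[OF S sm x, of u v] by (simp only: second)
qed

section \<open>Plane geometry\<close>

text \<open>The determinant with columns \<open>u\<close> and \<open>v\<close>; it turns "is a
  multiple of" into a polynomial equation.\<close>

definition cross2 :: "real^2 \<Rightarrow> real^2 \<Rightarrow> real" where
  "cross2 u v = u $ 1 * v $ 2 - u $ 2 * v $ 1"

lemma cross2_self [simp]: "cross2 u u = 0"
  by (simp add: cross2_def)

lemma cross2_add_left: "cross2 (u + v) w = cross2 u w + cross2 v w"
  and cross2_diff_left: "cross2 (u - v) w = cross2 u w - cross2 v w"
  and cross2_scaleR_left: "cross2 (c *\<^sub>R u) w = c * cross2 u w"
  by (simp_all add: cross2_def algebra_simps)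

lemma vec2_eq_axis: "(v :: real^2) = v $ 1 *\<^sub>R axis 1 1 + v $ 2 *\<^sub>R axis 2 1"
  by (simp add: vec_eq_iff forall_2 axis_def)

lemma linear_vec2:
  assumes "linear (A :: real^2 \<Rightarrow> 'a::real_vector)"
  shows "A v = v $ 1 *\<^sub>R A (axis 1 1) + v $ 2 *\<^sub>R A (axis 2 1)"
proof -
  have "A v = A (v $ 1 *\<^sub>R axis 1 1 + v $ 2 *\<^sub>R axis 2 1)" using vec2_eq_axis by metis
  then show ?thesis using assms by (simp add: linear_add linear_cmul)
qed

text \<open>The factor in front is the determinant of \<open>A\<close>.\<close>

lemma cross2_linear_image:
  assumes "linear A"
  shows "cross2 (A u) (A v) = cross2 (A (axis 1 1)) (A (axis 2 1)) * cross2 u v"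
  unfolding linear_vec2[OF assms, of u] linear_vec2[OF assms, of v]
  by (simp add: cross2_def algebra_simps)

lemma cross2_linear_image_eq_0_iff:
  assumes A: "linear A" and B: "linear B" and BA: "\<And>v. B (A v) = v"
  shows "cross2 (A u) (A v) = 0 \<longleftrightarrow> cross2 u v = 0"
  using cross2_linear_image[OF A, of u v] cross2_linear_image[OF B, of "A u" "A v"] BA by auto

lemma cross2_eq_0_iff: "u \<noteq> 0 \<Longrightarrow> cross2 w u = 0 \<longleftrightarrow> (\<exists>c. w = c *\<^sub>R u)"
proof
  assume u: "u \<noteq> 0" and c: "cross2 w u = 0"
  show "\<exists>c. w = c *\<^sub>R u"
  proof (cases "u $ 1 = 0")
    case True
    with u have "u $ 2 \<noteq> 0" by (auto simp: vec_eq_iff forall_2)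
    with True c show ?thesis
      by (intro exI[of _ "w $ 2 / u $ 2"]) (auto simp: vec_eq_iff forall_2 cross2_def)
  next
    case False
    with c show ?thesis
      by (intro exI[of _ "w $ 1 / u $ 1"]) (auto simp: vec_eq_iff forall_2 cross2_def field_simps)
  qed
qed (auto simp: cross2_scaleR_left)

text \<open>The kernel of a nonzero form on the plane is at most a line: for independent
  \<open>u\<close> and \<open>v\<close>, Cramer's rule expresses both values of \<open>l\<close> on
  the basis through \<open>l u\<close> and \<open>l v\<close>.\<close>

lemma cross2_eq_0_of_kernel:
  assumes l: "linear (l :: real^2 \<Rightarrow> real)" and nz: "l w \<noteq> 0" and u: "l u = 0" and v: "l v = 0"
  shows "cross2 u v = 0"
proof (rule ccontr)
  assume c: "cross2 u v \<noteq> 0"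
  have "cross2 u v * l (axis 1 1) = v $ 2 * l u - u $ 2 * l v"
    "cross2 u v * l (axis 2 1) = u $ 1 * l v - v $ 1 * l u"
    unfolding linear_vec2[OF l, of u] linear_vec2[OF l, of v]
    by (simp_all add: cross2_def algebra_simps)
  with c u v have "l (axis 1 1) = 0" "l (axis 2 1) = 0" by simp_all
  with nz linear_vec2[OF l, of w] show False by simp
qed

text \<open>
  Each coefficient times the homogeneous Vandermonde determinant of the four zeros
  is a combination of the four values (Cramer's rule).
\<close>

lemma binary_cubic_eq_0:
  fixes a b c d x1 y1 x2 y2 x3 y3 x4 y4 :: real
  defines "V \<equiv> (x1 * y2-y1 * x2) * (x1 * y3-y1 * x3) * (x1 * y4-y1 * x4) * (x2 * y3-y2 * x3) * (x2 * y4-y2 * x4) * (x3 * y4-y3 * x4)"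
  defines "f \<equiv> \<lambda>x y. a * x^3 + b * x^2 * y + c * x * y^2 + d * y^3"
  assumes V: "V \<noteq> 0" and f: "f x1 y1 = 0" "f x2 y2 = 0" "f x3 y3 = 0" "f x4 y4 = 0"
  shows "a = 0 \<and> b = 0 \<and> c = 0 \<and> d = 0"
proof -
  \<comment> \<open>\<open>W\<close> is the analogue of \<open>V\<close> for three points. Every
    cofactor is, up to sign, \<open>W\<close> at the remaining points times a polynomial symmetric
    in them.\<close>
  define W where "W p q r s t u = (p * s-q * r) * (p * u-q * t) * (r * u-s * t)" for p q r s t u :: real
  let ?W1 = "W x2 y2 x3 y3 x4 y4" and ?W2 = "W x1 y1 x3 y3 x4 y4"
  let ?W3 = "W x1 y1 x2 y2 x4 y4" and ?W4 = "W x1 y1 x2 y2 x3 y3"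
  have "a * V = f x1 y1 * (y2 * y3 * y4) * ?W1 - f x2 y2 * (y1 * y3 * y4) * ?W2
    + f x3 y3 * (y1 * y2 * y4) * ?W3 - f x4 y4 * (y1 * y2 * y3) * ?W4"
    unfolding V_def f_def W_def by algebra
  moreover have "d * V = - f x1 y1 * (x2 * x3 * x4) * ?W1 + f x2 y2 * (x1 * x3 * x4) * ?W2
    - f x3 y3 * (x1 * x2 * x4) * ?W3 + f x4 y4 * (x1 * x2 * x3) * ?W4"
    unfolding V_def f_def W_def by algebra
  moreover have "b * V = - f x1 y1 * (x2 * y3 * y4+y2 * x3 * y4+y2 * y3 * x4) * ?W1
    + f x2 y2 * (x1 * y3 * y4+y1 * x3 * y4+y1 * y3 * x4) * ?W2
    - f x3 y3 * (x1 * y2 * y4+y1 * x2 * y4+y1 * y2 * x4) * ?W3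
    + f x4 y4 * (x1 * y2 * y3+y1 * x2 * y3+y1 * y2 * x3) * ?W4"
    unfolding V_def f_def W_def by algebra
  moreover have "c * V = f x1 y1 * (x2 * x3 * y4+x2 * y3 * x4+y2 * x3 * x4) * ?W1
    - f x2 y2 * (x1 * x3 * y4+x1 * y3 * x4+y1 * x3 * x4) * ?W2
    + f x3 y3 * (x1 * x2 * y4+x1 * y2 * x4+y1 * x2 * x4) * ?W3
    - f x4 y4 * (x1 * x2 * y3+x1 * y2 * x3+y1 * x2 * x3) * ?W4"
    unfolding V_def f_def W_def by algebra
  ultimately show ?thesis using V f by simp
qed

section \<open>Diffeomorphisms and curves\<close>

lemma diffeomorphism_inverse:
  assumes "diffeomorphism U V \<phi>"
  shows "x \<in> U \<Longrightarrow> \<phi> x \<in> V" "x \<in> U \<Longrightarrow> inv_into U \<phi> (\<phi> x) = x"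
    "y \<in> V \<Longrightarrow> inv_into U \<phi> y \<in> U" "y \<in> V \<Longrightarrow> \<phi> (inv_into U \<phi> y) = y"
  using assms unfolding diffeomorphism_def
  by (auto simp: bij_betw_def inv_into_into f_inv_into_f)

lemma frechet_derivative_left_inverse:
  fixes f :: "'a::euclidean_space \<Rightarrow> 'b::euclidean_space" and g :: "'b \<Rightarrow> 'a"
  assumes "open S" "x \<in> S" "smooth_on S f" "smooth_on T g" "f x \<in> T" "\<And>y. y \<in> S \<Longrightarrow> g (f y) = y"
  shows "frechet_derivative g (at (f x)) (frechet_derivative f (at x) v) = v"
proof -
  have "((\<lambda>y. g (f y)) has_derivative (\<lambda>v. frechet_derivative g (at (f x)) (frechet_derivative f (at x) v))) (at x)"
    using assms by (intro has_derivative_compose[OF smooth_on_has_derivative smooth_on_has_derivative])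
  moreover have "((\<lambda>y. g (f y)) has_derivative (\<lambda>v. v)) (at x)"
    by (rule has_derivative_transform_within_open[OF has_derivative_ident assms(1,2)])
      (use assms(6) in simp)
  ultimately show ?thesis by (rule fun_cong[OF has_derivative_unique])
qed

lemma diffeomorphism_frechet_derivative_inverse:
  assumes "diffeomorphism U V \<phi>" "open U" "open V" "p \<in> U"
  shows "frechet_derivative (inv_into U \<phi>) (at (\<phi> p)) (frechet_derivative \<phi> (at p) v) = v"
    and "frechet_derivative \<phi> (at p) (frechet_derivative (inv_into U \<phi>) (at (\<phi> p)) v) = v"
proof -
  note d = diffeomorphism_inverse[OF assms(1)]
  have sm: "smooth_on U \<phi>" "smooth_on V (inv_into U \<phi>)"
    using assms(1) unfolding diffeomorphism_def by auto
  show "frechet_derivative (inv_into U \<phi>) (at (\<phi> p)) (frechet_derivative \<phi> (at p) v) = v"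
    by (rule frechet_derivative_left_inverse[OF assms(2,4) sm]) (use d assms(4) in auto)
  have "frechet_derivative \<phi> (at (inv_into U \<phi> (\<phi> p))) (frechet_derivative (inv_into U \<phi>) (at (\<phi> p)) v) = v"
    by (rule frechet_derivative_left_inverse[OF assms(3) _ sm(2,1)]) (use d assms(4) in auto)
  then show "frechet_derivative \<phi> (at p) (frechet_derivative (inv_into U \<phi>) (at (\<phi> p)) v) = v"
    using d(2) assms(4) by simp
qed

lemma velocity_eq_frechet:
  assumes "\<gamma> differentiable (at t)"
  shows "velocity \<gamma> t = frechet_derivative \<gamma> (at t) 1"
  using frechet_derivative_eq_vector_derivative[OF assms] by (simp add: velocity_def)

lemma velocity_has_derivative:
  assumes "open I" "smooth_on I \<gamma>" "t \<in> I"
  shows "(\<gamma> has_derivative (\<lambda>h. h *\<^sub>R velocity \<gamma> t)) (at t)"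
  using smooth_on_has_derivative[OF assms(2,3)]
    frechet_derivative_eq_vector_derivative[OF smooth_on_differentiable[OF assms(2,3)]]
  by (simp add: velocity_def)

lemma velocity_unique:
  assumes "(\<gamma> has_derivative (\<lambda>h. h *\<^sub>R v)) (at t)"
  shows "velocity \<gamma> t = v"
  using assms unfolding velocity_def by (intro vector_derivative_at) (simp add: has_vector_derivative_def)

lemma smooth_on_velocity:
  assumes "open I" "smooth_on I \<gamma>"
  shows "smooth_on I (velocity \<gamma>)"
  by (rule smooth_on_cong[OF assms(1) _ smooth_on_frechet_derivative[OF assms(2)]])
    (simp add: velocity_eq_frechet smooth_on_differentiable[OF assms(2)])

lemma velocity_compose:
  assumes "open I" "smooth_on I \<gamma>" "t \<in> I" "\<gamma> ` I \<subseteq> U" "smooth_on U \<phi>"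
  shows "velocity (\<lambda>s. \<phi> (\<gamma> s)) t = frechet_derivative \<phi> (at (\<gamma> t)) (velocity \<gamma> t)"
proof (rule velocity_unique)
  have U: "\<gamma> t \<in> U" using assms(3,4) by auto
  show "((\<lambda>s. \<phi> (\<gamma> s)) has_derivative (\<lambda>h. h *\<^sub>R frechet_derivative \<phi> (at (\<gamma> t)) (velocity \<gamma> t))) (at t)"
    using has_derivative_compose[OF velocity_has_derivative[OF assms(1-3)] smooth_on_has_derivative[OF assms(5) U]]
      linear_cmul[OF linear_frechet_smooth[OF assms(5) U]]
    by simp
qed

text \<open>The extra term is the second derivative of \<open>\<phi>\<close> on the velocity, the
  same inhomogeneous term that appears when connections are transported.\<close>

lemma second_velocity_compose:
  assumes "open I" "smooth_on I \<gamma>" "t \<in> I" "\<gamma> ` I \<subseteq> U" "open U" "smooth_on U \<phi>"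
  shows "velocity (velocity (\<lambda>s. \<phi> (\<gamma> s))) t
       = frechet_derivative \<phi> (at (\<gamma> t)) (velocity (velocity \<gamma>) t)
       + frechet_derivative (\<lambda>z. frechet_derivative \<phi> (at z) (velocity \<gamma> t)) (at (\<gamma> t)) (velocity \<gamma> t)"
    (is "_ = ?r")
proof (rule velocity_unique)
  have U: "\<gamma> t \<in> U" using assms(3,4) by auto
  have "((\<lambda>s. frechet_derivative \<phi> (at (\<gamma> s)) (velocity \<gamma> s)) has_derivative (\<lambda>h. h *\<^sub>R ?r)) (at t)"
    using has_derivative_frechet_apply[OF assms(1,3,5,4,6) velocity_has_derivative[OF assms(1-3)]
        velocity_has_derivative[OF assms(1) smooth_on_velocity[OF assms(1,2)] assms(3)]]
      linear_cmul[OF linear_frechet_smooth[OF assms(6) U]]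
      linear_cmul[OF linear_frechet_smooth[OF smooth_on_frechet_derivative[OF assms(6)] U]]
    by (simp add: scaleR_add_right)
  then show "(velocity (\<lambda>s. \<phi> (\<gamma> s)) has_derivative (\<lambda>h. h *\<^sub>R ?r)) (at t)"
    by (rule has_derivative_transform_within_open[OF _ assms(1,3)])
      (rule velocity_compose[OF assms(1,2) _ assms(4,6), symmetric])
qed

section \<open>Christoffel forms\<close>

definition christoffel :: "connection \<Rightarrow> plane \<Rightarrow> plane \<Rightarrow> plane \<Rightarrow> plane" where
  "christoffel Nab p u v = Nab (\<lambda>_. u) (\<lambda>_. v) p"

lemma acceleration_eq:
  "acceleration Nab \<gamma> t = velocity (velocity \<gamma>) t + christoffel Nab (\<gamma> t) (velocity \<gamma> t) (velocity \<gamma> t)"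
  by (simp add: acceleration_def christoffel_def velocity_def)

lemma smooth_on_component: "open S \<Longrightarrow> smooth_on S X \<Longrightarrow> smooth_on S (\<lambda>q. X q $ i)"
  for X :: "_ \<Rightarrow> real^'n"
  by (rule smooth_on_bounded_linear[OF _ bounded_linear_vec_nth])

context
  fixes D :: "plane set" and Nab :: connection
  assumes D: "open D" and Nab: "affine_connection D Nab"
begin

lemmas affine_connection_axioms = Nab[unfolded affine_connection_def]
lemmas affine_connection_smooth = affine_connection_axioms[THEN conjunct1, rule_format]
  and affine_connection_add_left = affine_connection_axioms[THEN conjunct2, THEN conjunct1, rule_format]
  and affine_connection_scaleR_left =
    affine_connection_axioms[THEN conjunct2, THEN conjunct2, THEN conjunct1, rule_format]
  and affine_connection_add_right =
    affine_connection_axioms[THEN conjunct2, THEN conjunct2, THEN conjunct2, THEN conjunct1, rule_format]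
  and affine_connection_scaleR_right =
    affine_connection_axioms[THEN conjunct2, THEN conjunct2, THEN conjunct2, THEN conjunct2,
      THEN conjunct1, rule_format]
  and affine_connection_torsion_free =
    affine_connection_axioms[THEN conjunct2, THEN conjunct2, THEN conjunct2, THEN conjunct2,
      THEN conjunct2, rule_format]

text \<open>The splitting of \<open>X\<close> into components holds at all points of the plane, so
  additivity and function-linearity apply directly.\<close>

lemma affine_connection_left_coords:
  assumes X: "smooth_on D X" and Y: "smooth_on D Y" and p: "p \<in> D"
  shows "Nab X Y p = X p $ 1 *\<^sub>R Nab (\<lambda>_. axis 1 1) Y p + X p $ 2 *\<^sub>R Nab (\<lambda>_. axis 2 1) Y p"
proof -
  have comp: "smooth_on D (\<lambda>q. X q $ i *\<^sub>R axis i (1::real))" for i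
    by (rule smooth_on_scaleR[OF D smooth_on_component[OF D X] smooth_on_const])
  have "X = (\<lambda>q. X q $ 1 *\<^sub>R axis 1 1 + X q $ 2 *\<^sub>R axis 2 1)"
    by (rule ext) (rule vec2_eq_axis)
  then have "Nab X Y p = Nab (\<lambda>q. X q $ 1 *\<^sub>R axis 1 1 + X q $ 2 *\<^sub>R axis 2 1) Y p"
    by (rule arg_cong[where f = "\<lambda>Z. Nab Z Y p"])
  also have "\<dots> = Nab (\<lambda>q. X q $ 1 *\<^sub>R axis 1 1) Y p + Nab (\<lambda>q. X q $ 2 *\<^sub>R axis 2 1) Y p"
    by (rule affine_connection_add_left[OF comp comp Y p])
  finally have sum: "Nab X Y p = \<dots>" .
  have "Nab (\<lambda>q. X q $ i *\<^sub>R axis i 1) Y p = X p $ i *\<^sub>R Nab (\<lambda>_. axis i 1) Y p" for i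
    by (rule affine_connection_scaleR_left[OF smooth_on_component[OF D X] smooth_on_const Y p])
  then show ?thesis by (simp only: sum)
qed

lemma affine_connection_right_coords:
  assumes X: "smooth_on D X" and Y: "smooth_on D Y" and p: "p \<in> D"
  shows "Nab X Y p = frechet_derivative Y (at p) (X p)
    + (Y p $ 1 *\<^sub>R Nab X (\<lambda>_. axis 1 1) p + Y p $ 2 *\<^sub>R Nab X (\<lambda>_. axis 2 1) p)"
proof -
  have comp: "smooth_on D (\<lambda>q. Y q $ i *\<^sub>R axis i (1::real))" for i
    by (rule smooth_on_scaleR[OF D smooth_on_component[OF D Y] smooth_on_const])
  have "Y = (\<lambda>q. Y q $ 1 *\<^sub>R axis 1 1 + Y q $ 2 *\<^sub>R axis 2 1)"
    by (rule ext) (rule vec2_eq_axis)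
  then have "Nab X Y p = Nab X (\<lambda>q. Y q $ 1 *\<^sub>R axis 1 1 + Y q $ 2 *\<^sub>R axis 2 1) p"
    by (rule arg_cong[where f = "\<lambda>Z. Nab X Z p"])
  also have "\<dots> = Nab X (\<lambda>q. Y q $ 1 *\<^sub>R axis 1 1) p + Nab X (\<lambda>q. Y q $ 2 *\<^sub>R axis 2 1) p"
    by (rule affine_connection_add_right[OF X comp comp p])
  finally have sum: "Nab X Y p = \<dots>" .
  have "Nab X (\<lambda>q. Y q $ i *\<^sub>R axis i 1) p
      = frechet_derivative (\<lambda>q. Y q $ i) (at p) (X p) *\<^sub>R axis i 1 + Y p $ i *\<^sub>R Nab X (\<lambda>_. axis i 1) p" for i
    by (rule affine_connection_scaleR_right[OF smooth_on_component[OF D Y] X smooth_on_const p])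
  moreover have "frechet_derivative (\<lambda>q. Y q $ i) (at p) (X p) = frechet_derivative Y (at p) (X p) $ i" for i
    using frechet_derivative_has_derivative[OF bounded_linear.has_derivative[OF bounded_linear_vec_nth
          smooth_on_has_derivative[OF Y p]]] by simp
  moreover note vec2_eq_axis[of "frechet_derivative Y (at p) (X p)"]
  ultimately show ?thesis unfolding sum by (simp add: algebra_simps)
qed

text \<open>The coordinate expansions see \<open>X\<close> only through \<open>X p\<close>, and
  \<open>Y\<close> only through \<open>Y p\<close> and its derivative at \<open>p\<close>; hence
  both fields can be replaced by constant ones once that derivative is split off.\<close>

lemma affine_connection_christoffel:
  assumes X: "smooth_on D X" and Y: "smooth_on D Y" and p: "p \<in> D"
  shows "Nab X Y p = frechet_derivative Y (at p) (X p) + christoffel Nab p (X p) (Y p)"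
proof -
  have "Nab X Y p = Nab (\<lambda>_. X p) Y p"
    unfolding affine_connection_left_coords[OF X Y p]
      affine_connection_left_coords[OF smooth_on_const Y p, of "X p"] ..
  also have "\<dots> = frechet_derivative Y (at p) (X p) + Nab (\<lambda>_. X p) (\<lambda>_. Y p) p"
    unfolding affine_connection_right_coords[OF smooth_on_const Y p, of "X p"]
      affine_connection_right_coords[OF smooth_on_const smooth_on_const p, of "X p" "Y p"]
    by simp
  finally show ?thesis by (simp add: christoffel_def)
qed

lemma christoffel_symmetric:
  assumes "p \<in> D"
  shows "christoffel Nab p u v = christoffel Nab p v u"
proof -
  have "Nab (\<lambda>_. u) (\<lambda>_. v) p - Nab (\<lambda>_. v) (\<lambda>_. u) p = lie_bracket (\<lambda>_. u) (\<lambda>_. v) p"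
    by (rule affine_connection_torsion_free[OF smooth_on_const smooth_on_const assms])
  then show ?thesis by (simp add: christoffel_def lie_bracket_def)
qed

lemma christoffel_left_coords:
  assumes "p \<in> D"
  shows "christoffel Nab p u v
    = u $ 1 *\<^sub>R christoffel Nab p (axis 1 1) v + u $ 2 *\<^sub>R christoffel Nab p (axis 2 1) v"
  using affine_connection_left_coords[OF smooth_on_const smooth_on_const assms, of u v]
  by (simp add: christoffel_def)

lemma linear_christoffel_left:
  assumes "p \<in> D"
  shows "linear (\<lambda>u. christoffel Nab p u v)"
proof (rule linearI)
  fix x y c
  show "christoffel Nab p (x + y) v = christoffel Nab p x v + christoffel Nab p y v"
    unfolding christoffel_left_coords[OF assms, of "x + y"] christoffel_left_coords[OF assms, of x]
      christoffel_left_coords[OF assms, of y]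
    by (simp add: algebra_simps)
  show "christoffel Nab p (c *\<^sub>R x) v = c *\<^sub>R christoffel Nab p x v"
    unfolding christoffel_left_coords[OF assms, of "c *\<^sub>R x"] christoffel_left_coords[OF assms, of x]
    by (simp add: algebra_simps)
qed

lemma linear_christoffel_right:
  assumes "p \<in> D"
  shows "linear (christoffel Nab p u)"
  using linear_christoffel_left[OF assms, of u] christoffel_symmetric[OF assms]
  by (simp add: linear_iff)

lemma smooth_on_christoffel: "smooth_on D (\<lambda>p. christoffel Nab p u v)"
  unfolding christoffel_def by (rule affine_connection_smooth[OF smooth_on_const smooth_on_const])

end

text \<open>Converse of \<open>affine_connection_christoffel\<close>: the derivative term accounts
  for the Leibniz rule and the Lie bracket, so only linearity and symmetry of \<open>K\<close>
  remain to be checked for a transported connection.\<close>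

lemma affine_connectionI:
  assumes D: "open D"
    and sm: "\<And>X Y. smooth_on D X \<Longrightarrow> smooth_on D Y \<Longrightarrow> smooth_on D (Nab X Y)"
    and eq: "\<And>X Y p. smooth_on D X \<Longrightarrow> smooth_on D Y \<Longrightarrow> p \<in> D \<Longrightarrow>
      Nab X Y p = frechet_derivative Y (at p) (X p) + K p (X p) (Y p)"
    and left: "\<And>p v. p \<in> D \<Longrightarrow> linear (\<lambda>u. K p u v)"
    and sym: "\<And>p u v. p \<in> D \<Longrightarrow> K p u v = K p v u"
  shows "affine_connection D Nab"
proof -
  have right: "linear (K p u)" if "p \<in> D" for p u
    using left[OF that, of u] sym[OF that] by (simp add: linear_iff)
  note lin = linear_add[OF left] linear_cmul[OF left] linear_add[OF right] linear_cmul[OF right]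
    linear_add[OF linear_frechet_smooth] linear_cmul[OF linear_frechet_smooth]
  have add: "frechet_derivative (\<lambda>q. Y q + Z q) (at p) v = frechet_derivative Y (at p) v + frechet_derivative Z (at p) v"
    if "smooth_on D Y" "smooth_on D Z" "p \<in> D" for Y Z :: "plane \<Rightarrow> plane" and p v
    using frechet_derivative_has_derivative[OF has_derivative_add[OF smooth_on_has_derivative[OF that(1,3)]
        smooth_on_has_derivative[OF that(2,3)]]]
    by simp
  have scale: "frechet_derivative (\<lambda>q. f q *\<^sub>R Y q) (at p) v
      = f p *\<^sub>R frechet_derivative Y (at p) v + frechet_derivative f (at p) v *\<^sub>R Y p"
    if "smooth_on D f" "smooth_on D Y" "p \<in> D" for f :: "plane \<Rightarrow> real" and Y :: "plane \<Rightarrow> plane" and p v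
    using frechet_derivative_has_derivative[OF has_derivative_scaleR[OF smooth_on_has_derivative[OF that(1,3)]
        smooth_on_has_derivative[OF that(2,3)]]]
    by simp
  show ?thesis
    unfolding affine_connection_def
  proof (intro conjI allI impI ballI)
    fix X Y :: "plane \<Rightarrow> plane" and p
    assume "smooth_on D X" "smooth_on D Y" "p \<in> D"
    then show "Nab X Y p - Nab Y X p = lie_bracket X Y p"
      using sym[of p "X p" "Y p"] by (simp add: eq lie_bracket_def)
  qed (simp_all add: sm eq smooth_on_add[OF D] smooth_on_scaleR[OF D] lin add scale algebra_simps)
qed

section \<open>Transport of connections\<close>

context
  fixes D D' :: "plane set" and \<phi> :: "plane \<Rightarrow> plane"
  assumes D: "open D" and D': "open D'" and diffeo: "diffeomorphism D D' \<phi>"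
begin

lemmas diffeo_inverse = diffeomorphism_inverse[OF diffeo]
lemmas frechet_inverse = diffeomorphism_frechet_derivative_inverse[OF diffeo D D']

lemma diffeo_smooth: "smooth_on D \<phi>" "smooth_on D' (inv_into D \<phi>)"
  using diffeo unfolding diffeomorphism_def by auto

lemma diffeo_image: "\<phi> ` D \<subseteq> D'" "inv_into D \<phi> ` D' \<subseteq> D"
  using diffeo_inverse by auto

lemma push_field_image: "p \<in> D \<Longrightarrow> push_field D \<phi> X (\<phi> p) = frechet_derivative \<phi> (at p) (X p)"
  by (simp add: push_field_def diffeo_inverse(2))

lemma smooth_on_push_field:
  assumes "smooth_on D X"
  shows "smooth_on D' (push_field D \<phi> X)"
  unfolding push_field_def[abs_def] Let_def
  by (rule smooth_on_frechet_apply[OF D' diffeo_image(2) diffeo_smooth(2) diffeo_smooth(1)])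
    (rule smooth_on_compose[OF D' diffeo_image(2) diffeo_smooth(2) assms])

text \<open>Both sides differentiate the identity \<open>push_field_image\<close> at
  \<open>p\<close> along \<open>w\<close>, the left by the chain rule and the right by the product
  rule.\<close>

lemma push_field_derivative:
  assumes X: "smooth_on D X" and p: "p \<in> D"
  shows "frechet_derivative (push_field D \<phi> X) (at (\<phi> p)) (frechet_derivative \<phi> (at p) w)
    = frechet_derivative \<phi> (at p) (frechet_derivative X (at p) w)
    + frechet_derivative (\<lambda>z. frechet_derivative \<phi> (at z) (X p)) (at p) w"
proof -
  have "((\<lambda>y. push_field D \<phi> X (\<phi> y)) has_derivative
      (\<lambda>w. frechet_derivative (push_field D \<phi> X) (at (\<phi> p)) (frechet_derivative \<phi> (at p) w))) (at p)"
    by (rule has_derivative_compose[OF smooth_on_has_derivative[OF diffeo_smooth(1) p]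
          smooth_on_has_derivative[OF smooth_on_push_field[OF X] diffeo_inverse(1)[OF p]]])
  moreover have "((\<lambda>y. push_field D \<phi> X (\<phi> y)) has_derivative
      (\<lambda>w. frechet_derivative \<phi> (at p) (frechet_derivative X (at p) w)
        + frechet_derivative (\<lambda>z. frechet_derivative \<phi> (at z) (X p)) (at p) w)) (at p)"
  proof (rule has_derivative_transform_within_open[OF _ D p])
    show "((\<lambda>y. frechet_derivative \<phi> (at y) (X y)) has_derivative
      (\<lambda>w. frechet_derivative \<phi> (at p) (frechet_derivative X (at p) w)
        + frechet_derivative (\<lambda>z. frechet_derivative \<phi> (at z) (X p)) (at p) w)) (at p)"
      by (rule has_derivative_frechet_apply[OF D p D _ diffeo_smooth(1) has_derivative_ident
            smooth_on_has_derivative[OF X p]]) simp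
  qed (simp add: push_field_image)
  ultimately show ?thesis by (rule fun_cong[OF has_derivative_unique])
qed

text \<open>Testing the carrying relation on the constant field with value \<open>u\<close> gives
  the transformation law of Christoffel forms. Its Hessian term \<open>H\<close> is exactly the one
  produced by the second velocity of the image curve, so accelerations transform as vectors.\<close>

lemma carries_connection_acceleration:
  assumes Nab': "affine_connection D' Nab'"
    and carries: "carries_connection D D' \<phi> Nab Nab'"
    and \<gamma>: "open I" "smooth_on I \<gamma>" "t \<in> I" "\<gamma> ` I \<subseteq> D"
  shows "acceleration Nab' (\<lambda>s. \<phi> (\<gamma> s)) t = frechet_derivative \<phi> (at (\<gamma> t)) (acceleration Nab \<gamma> t)"
proof -
  define p u where "p = \<gamma> t" and "u = velocity \<gamma> t"
  define A H where "A = frechet_derivative \<phi> (at p)"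
    and "H = frechet_derivative (\<lambda>z. frechet_derivative \<phi> (at z) u) (at p) u"
  let ?Y = "push_field D \<phi> (\<lambda>_. u)"
  have p: "p \<in> D" using \<gamma>(3,4) by (auto simp: p_def)
  have "linear A" unfolding A_def by (rule linear_frechet_smooth[OF diffeo_smooth(1) p])
  have "A (christoffel Nab p u u) = push_field D \<phi> (Nab (\<lambda>_. u) (\<lambda>_. u)) (\<phi> p)"
    by (simp add: push_field_image[OF p] christoffel_def A_def)
  also have "\<dots> = Nab' ?Y ?Y (\<phi> p)"
    using carries smooth_on_const[of D u] diffeo_inverse(1)[OF p]
    unfolding carries_connection_def by metis
  also have "\<dots> = frechet_derivative ?Y (at (\<phi> p)) (A u) + christoffel Nab' (\<phi> p) (A u) (A u)"
    using affine_connection_christoffel[OF D' Nab' smooth_on_push_field[OF smooth_on_const]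
        smooth_on_push_field[OF smooth_on_const] diffeo_inverse(1)[OF p], of u u]
    by (simp add: push_field_image[OF p] A_def)
  also have "frechet_derivative ?Y (at (\<phi> p)) (A u) = H"
    using push_field_derivative[OF smooth_on_const p, of u u] linear_0[OF \<open>linear A\<close>]
    by (simp add: A_def H_def)
  finally have "A (christoffel Nab p u u) = H + christoffel Nab' (\<phi> p) (A u) (A u)" .
  moreover have "velocity (velocity (\<lambda>s. \<phi> (\<gamma> s))) t = A (velocity (velocity \<gamma>) t) + H"
    unfolding A_def H_def p_def u_def by (rule second_velocity_compose[OF \<gamma> D diffeo_smooth(1)])
  moreover have "velocity (\<lambda>s. \<phi> (\<gamma> s)) t = A u"
    unfolding A_def p_def u_def by (rule velocity_compose[OF \<gamma> diffeo_smooth(1)])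
  ultimately show ?thesis
    using linear_add[OF \<open>linear A\<close>]
    by (simp add: acceleration_eq flip: p_def u_def A_def)
qed

text \<open>Written with \<open>push_field\<close> so that being carried to \<open>Nab'\<close>
  holds by construction; that it is an affine connection is then the part to prove.\<close>

definition pull_connection :: "connection \<Rightarrow> connection" where
  "pull_connection Nab' X Y p = frechet_derivative (inv_into D \<phi>) (at (\<phi> p))
     (Nab' (push_field D \<phi> X) (push_field D \<phi> Y) (\<phi> p))"

lemma carries_pull_connection: "carries_connection D D' \<phi> (pull_connection Nab') Nab'"
  unfolding carries_connection_def
proof (intro allI impI ballI)
  fix X Y q
  assume "q \<in> D'"
  then show "Nab' (push_field D \<phi> X) (push_field D \<phi> Y) q = push_field D \<phi> (pull_connection Nab' X Y) q"
    using push_field_image[of "inv_into D \<phi> q" "pull_connection Nab' X Y"]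
      frechet_inverse(2)[of "inv_into D \<phi> q"] diffeo_inverse(3,4)
    by (simp add: pull_connection_def)
qed

lemma affine_connection_pull_connection:
  assumes Nab': "affine_connection D' Nab'"
  shows "affine_connection D (pull_connection Nab')"
proof -
  define A B where "A p = frechet_derivative \<phi> (at p)"
    and "B p = frechet_derivative (inv_into D \<phi>) (at (\<phi> p))" for p
  define H where "H p u v = frechet_derivative (\<lambda>z. frechet_derivative \<phi> (at z) v) (at p) u" for p u v
  \<comment> \<open>The classical transformation law of Christoffel symbols. Its symmetry combines
    that of the second derivative \<open>H\<close> with the torsion-freeness of
    \<open>Nab'\<close>.\<close>
  define K where "K p u v = B p (H p u v + christoffel Nab' (\<phi> p) (A p u) (A p v))" for p u v
  have linA: "linear (A p)" and linB: "linear (B p)" and linH: "linear (\<lambda>u. H p u v)"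
    and \<phi>p: "\<phi> p \<in> D'" and BA: "B p (A p u) = u" if p: "p \<in> D" for p u v
    unfolding A_def B_def H_def
    by (rule linear_frechet_smooth[OF diffeo_smooth(1) p]
        linear_frechet_smooth[OF diffeo_smooth(2) diffeo_inverse(1)[OF p]]
        linear_frechet_smooth[OF smooth_on_frechet_derivative[OF diffeo_smooth(1)] p]
        diffeo_inverse(1)[OF p] frechet_inverse(1)[OF p])+
  show ?thesis
  proof (rule affine_connectionI[OF D])
    fix X Y :: "plane \<Rightarrow> plane"
    assume X: "smooth_on D X" and Y: "smooth_on D Y"
    have "smooth_on D (\<lambda>p. Nab' (push_field D \<phi> X) (push_field D \<phi> Y) (\<phi> p))"
      by (rule smooth_on_compose[OF D diffeo_image(1) diffeo_smooth(1)
            affine_connection_smooth[OF D' Nab' smooth_on_push_field[OF X] smooth_on_push_field[OF Y]]])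
    then show "smooth_on D (pull_connection Nab' X Y)"
      unfolding pull_connection_def[abs_def]
      by (rule smooth_on_frechet_apply[OF D diffeo_image(1) diffeo_smooth])
    fix p
    assume p: "p \<in> D"
    have "pull_connection Nab' X Y p = B p (frechet_derivative (push_field D \<phi> Y) (at (\<phi> p)) (A p (X p))
        + christoffel Nab' (\<phi> p) (A p (X p)) (A p (Y p)))"
      unfolding pull_connection_def
        affine_connection_christoffel[OF D' Nab' smooth_on_push_field[OF X] smooth_on_push_field[OF Y] \<phi>p[OF p]]
      by (simp add: push_field_image[OF p] A_def B_def)
    also have "frechet_derivative (push_field D \<phi> Y) (at (\<phi> p)) (A p (X p))
        = A p (frechet_derivative Y (at p) (X p)) + H p (X p) (Y p)"
      unfolding A_def H_def by (rule push_field_derivative[OF Y p])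
    finally show "pull_connection Nab' X Y p = frechet_derivative Y (at p) (X p) + K p (X p) (Y p)"
      using linear_add[OF linB[OF p]] BA[OF p] by (simp add: K_def add.assoc)
  next
    fix p u v
    assume p: "p \<in> D"
    show "linear (\<lambda>u. K p u v)"
      using linear_add[OF linA[OF p]] linear_cmul[OF linA[OF p]] linear_add[OF linB[OF p]]
        linear_cmul[OF linB[OF p]] linear_add[OF linH[OF p]] linear_cmul[OF linH[OF p]]
        linear_add[OF linear_christoffel_left[OF D' Nab' \<phi>p[OF p]]]
        linear_cmul[OF linear_christoffel_left[OF D' Nab' \<phi>p[OF p]]]
      by (intro linearI) (simp_all add: K_def algebra_simps)
    show "K p u v = K p v u"
      using second_derivative_symmetric[OF D diffeo_smooth(1) p]
        christoffel_symmetric[OF D' Nab' \<phi>p[OF p]]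
      unfolding K_def H_def by metis
  qed
qed

end

section \<open>Projective equivalence\<close>

text \<open>The set \<open>I\<close> only labels four directions, later the foliations of the web;
  \<open>u\<close> may depend on \<open>p\<close> arbitrarily.\<close>

lemma projectively_equivalent_of_four_directions:
  assumes D: "open D" and Nab: "affine_connection D Nab" and Nab': "affine_connection D Nab'"
    and I: "card I = 4"
    and dirs: "\<And>p. p \<in> D \<Longrightarrow> \<exists>u. pairwise (\<lambda>i j. cross2 (u i) (u j) \<noteq> 0) I \<and>
      (\<forall>i\<in>I. cross2 (christoffel Nab p (u i) (u i) - christoffel Nab' p (u i) (u i)) (u i) = 0)"
  shows "projectively_equivalent D Nab Nab'"
proof -
  define S where "S p u v = christoffel Nab p u v - christoffel Nab' p u v" for p u v
  define e1 e2 :: plane where "e1 = axis 1 1" and "e2 = axis 2 1"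
  \<comment> \<open>Forced by the wanted identity: on the two basis vectors it reads
    \<open>S p e1 e2 = \<rho>(e1) e2 + \<rho>(e2) e1\<close>, so the components of
    \<open>S p e1 e2\<close> are the values of \<open>\<rho>\<close> in swapped order.\<close>
  define \<rho> where "\<rho> p = S p e1 e2 $ 2 *\<^sub>R blinfun_inner_left e1 + S p e1 e2 $ 1 *\<^sub>R blinfun_inner_left e2" for p
  have S_coords: "S p u v = (u $ 1 * v $ 1) *\<^sub>R S p e1 e1 + (u $ 1 * v $ 2 + u $ 2 * v $ 1) *\<^sub>R S p e1 e2
      + (u $ 2 * v $ 2) *\<^sub>R S p e2 e2" if "p \<in> D" for p u v
  proof -
    have *: "christoffel N p u v = (u $ 1 * v $ 1) *\<^sub>R christoffel N p e1 e1
        + (u $ 1 * v $ 2 + u $ 2 * v $ 1) *\<^sub>R christoffel N p e1 e2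
        + (u $ 2 * v $ 2) *\<^sub>R christoffel N p e2 e2" if N: "affine_connection D N" for N
      using linear_vec2[OF linear_christoffel_left[OF D N \<open>p \<in> D\<close>], of u v]
        linear_vec2[OF linear_christoffel_right[OF D N \<open>p \<in> D\<close>], of e1 v]
        linear_vec2[OF linear_christoffel_right[OF D N \<open>p \<in> D\<close>], of e2 v]
        christoffel_symmetric[OF D N \<open>p \<in> D\<close>, of e2 e1]
      by (simp add: algebra_simps flip: e1_def e2_def)
    show ?thesis unfolding S_def *[OF Nab] *[OF Nab'] by (simp add: algebra_simps)
  qed
  \<comment> \<open>These relations say that \<open>S p e1 e1\<close> is
    \<open>2 \<rho>(e1) e1\<close> and \<open>S p e2 e2\<close> is \<open>2 \<rho>(e2) e2\<close>.
    They are the vanishing of the four coefficients of the cubic below.\<close>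
  have trace: "S p e1 e1 $ 2 = 0 \<and> S p e1 e1 $ 1 = 2 * S p e1 e2 $ 2
      \<and> S p e2 e2 $ 2 = 2 * S p e1 e2 $ 1 \<and> S p e2 e2 $ 1 = 0" if p: "p \<in> D" for p
  proof -
    obtain u where pw: "pairwise (\<lambda>i j. cross2 (u i) (u j) \<noteq> 0) I"
      and zero: "\<And>i. i \<in> I \<Longrightarrow> cross2 (S p (u i) (u i)) (u i) = 0"
      using dirs[OF p] unfolding S_def by blast
    obtain i j k l where ijkl: "I = {i, j, k, l}" "distinct [i, j, k, l]"
      using I by (auto simp: card_Suc_eq eval_nat_numeral)
    have cubic: "- S p e1 e1 $ 2 * (u m $ 1)^3 + (S p e1 e1 $ 1 - 2 * S p e1 e2 $ 2) * (u m $ 1)^2 * u m $ 2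
        + (2 * S p e1 e2 $ 1 - S p e2 e2 $ 2) * u m $ 1 * (u m $ 2)^2 + S p e2 e2 $ 1 * (u m $ 2)^3 = 0"
      if "m \<in> I" for m
      using zero[OF that] unfolding S_coords[OF p, of "u m" "u m"] cross2_def
      by (simp add: algebra_simps power2_eq_square power3_eq_cube)
    have nz: "u m $ 1 * u n $ 2 - u m $ 2 * u n $ 1 \<noteq> 0" if "m \<in> I" "n \<in> I" "m \<noteq> n" for m n
      using pw that unfolding pairwise_def cross2_def by blast
    show ?thesis
      using binary_cubic_eq_0[OF _ cubic[of i] cubic[of j] cubic[of k] cubic[of l]] ijkl nz by simp
  qed
  have "smooth_on D \<rho>"
    unfolding \<rho>_def[abs_def] S_def
    by (rule smooth_on_add[OF D] smooth_on_scaleR[OF D] smooth_on_component[OF D] smooth_on_diff[OF D]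
        smooth_on_const smooth_on_christoffel[OF D Nab] smooth_on_christoffel[OF D Nab'])+
  moreover have "Nab X Y p - Nab' X Y p = blinfun_apply (\<rho> p) (X p) *\<^sub>R Y p + blinfun_apply (\<rho> p) (Y p) *\<^sub>R X p"
    if "smooth_on D X" "smooth_on D Y" "p \<in> D" for X Y p
  proof -
    have "Nab X Y p - Nab' X Y p = S p (X p) (Y p)"
      using affine_connection_christoffel[OF D Nab that] affine_connection_christoffel[OF D Nab' that]
      by (simp add: S_def)
    also have "\<dots> = blinfun_apply (\<rho> p) (X p) *\<^sub>R Y p + blinfun_apply (\<rho> p) (Y p) *\<^sub>R X p"
      using trace[OF that(3)] unfolding S_coords[OF that(3), of "X p" "Y p"]
      by (simp add: vec_eq_iff forall_2 \<rho>_def blinfun.add_left blinfun.scaleR_left e1_def e2_def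
          inner_axis inner_axis' algebra_simps)
    finally show ?thesis .
  qed
  ultimately show ?thesis unfolding projectively_equivalent_def by blast
qed

section \<open>Webs\<close>

lemma leaf_tangent_velocity:
  "0 < \<epsilon> \<Longrightarrow> smooth_on {-\<epsilon><..<\<epsilon>} \<gamma> \<Longrightarrow> \<gamma> ` {-\<epsilon><..<\<epsilon>} \<subseteq> L \<Longrightarrow> \<gamma> 0 = p
    \<Longrightarrow> velocity \<gamma> 0 \<in> leaf_tangent L p"
  unfolding leaf_tangent_def by blast

text \<open>The second chart coordinate is constant along a plaque, so its differential kills every
  velocity in the leaf. Only this upper bound on the tangent set comes from the chart; nonzero
  tangents will come from transversality.\<close>

lemma leaf_tangent_subset_kernel:
  assumes F: "foliation D F" and L: "L \<in> F" and p: "p \<in> L"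
  shows "\<exists>l :: plane \<Rightarrow> real. linear l \<and> (\<exists>w. l w \<noteq> 0) \<and> (\<forall>v\<in>leaf_tangent L p. l v = 0)"
proof -
  have "p \<in> D" using F L p unfolding foliation_def partition_on_def by blast
  then obtain U \<psi> where pU: "p \<in> U" and chart: "foliated_chart D F U \<psi>"
    using F unfolding foliation_def by blast
  have U: "open U" and d: "diffeomorphism U (\<psi> ` U) \<psi>" and o: "open (\<psi> ` U)"
    and slice: "\<And>C. C \<in> components (U \<inter> L) \<Longrightarrow> \<exists>c. C = {q \<in> U. \<psi> q $ 2 = c}"
    using chart L unfolding foliated_chart_def by auto
  have sm: "smooth_on U \<psi>" using d unfolding diffeomorphism_def by blast
  define l where "l v = frechet_derivative \<psi> (at p) v $ 2" for v
  have "linear l"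
    using linear_frechet_smooth[OF sm pU] by (simp add: l_def linear_iff)
  \<comment> \<open>The witness is the vector that the chart derivative maps to the second basis
    vector.\<close>
  moreover have "l (frechet_derivative (inv_into U \<psi>) (at (\<psi> p)) (axis 2 1)) \<noteq> 0"
    unfolding l_def diffeomorphism_frechet_derivative_inverse(2)[OF d U o pU] by (simp add: axis_def)
  moreover have "l v = 0" if tangent: "v \<in> leaf_tangent L p" for v
  proof -
    obtain \<gamma> \<epsilon> where v: "v = velocity \<gamma> 0" and \<epsilon>: "0 < \<epsilon>" and \<gamma>: "smooth_on {-\<epsilon><..<\<epsilon>} \<gamma>"
      "\<gamma> ` {-\<epsilon><..<\<epsilon>} \<subseteq> L" "\<gamma> 0 = p"
      using tangent unfolding leaf_tangent_def by blast
    have "isCont \<gamma> 0"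
      using smooth_on_continuous_on[OF \<gamma>(1)] \<epsilon> by (simp add: continuous_on_eq_continuous_at)
    then have "(\<gamma> \<longlongrightarrow> \<gamma> 0) (nhds 0)"
      unfolding continuous_at tendsto_at_iff_tendsto_nhds .
    from topological_tendstoD[OF this U] pU \<gamma>(3) have "\<forall>\<^sub>F t in nhds 0. \<gamma> t \<in> U"
      by simp
    then obtain \<delta> where \<delta>: "0 < \<delta>" "\<And>t. dist t 0 < \<delta> \<Longrightarrow> \<gamma> t \<in> U"
      unfolding eventually_nhds_metric by blast
    define I where "I = {- min \<epsilon> \<delta><..<min \<epsilon> \<delta>}"
    have sub: "I \<subseteq> {-\<epsilon><..<\<epsilon>}" "I \<subseteq> ball 0 \<delta>" by (auto simp: I_def)
    have "\<gamma> ` I \<subseteq> L" using sub(1) \<gamma>(2) by blast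
    moreover have "\<gamma> ` I \<subseteq> U" using sub(2) \<delta>(2) by (auto simp: dist_commute)
    ultimately have I: "open I" "0 \<in> I" "connected I" "\<gamma> ` I \<subseteq> U \<inter> L" "smooth_on I \<gamma>"
      using \<epsilon> \<delta>(1) smooth_on_subset[OF \<gamma>(1) sub(1)] by (auto simp: I_def)
    \<comment> \<open>A leaf may cross the chart in many plaques. Connectedness of the short arc
      keeps it in a single one.\<close>
    have "connected (\<gamma> ` I)"
      by (rule connected_continuous_image[OF smooth_on_continuous_on[OF I(5)] I(3)])
    moreover have "\<gamma> ` I \<noteq> {}" "U \<inter> L \<noteq> {}" using I(2,4) by auto
    ultimately obtain C where C: "C \<in> components (U \<inter> L)" "\<gamma> ` I \<subseteq> C"
      using exists_component_superset[OF I(4)] by blast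
    obtain c where "C = {q \<in> U. \<psi> q $ 2 = c}" using slice[OF C(1)] by blast
    then have const: "\<psi> (\<gamma> t) $ 2 = c" if "t \<in> I" for t using C(2) that by auto
    have "((\<lambda>t. \<psi> (\<gamma> t) $ 2) has_derivative (\<lambda>h. l (h *\<^sub>R v))) (at 0)"
      unfolding l_def
      using bounded_linear.has_derivative[OF bounded_linear_vec_nth has_derivative_compose[OF
          velocity_has_derivative[OF I(1,5,2)] smooth_on_has_derivative[OF sm]]] pU v \<gamma>(3)
      by blast
    moreover have "((\<lambda>t. \<psi> (\<gamma> t) $ 2) has_derivative (\<lambda>h. 0)) (at 0)"
      by (rule has_derivative_transform_within_open[OF has_derivative_const I(1,2)])
        (use const in auto)
    ultimately have "(\<lambda>h. l (h *\<^sub>R v)) = (\<lambda>h. 0)" by (rule has_derivative_unique)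
    from fun_cong[OF this, of 1] show ?thesis by simp
  qed
  ultimately show ?thesis by blast
qed

text \<open>A tangent vector comes with a curve whose velocity may vanish away from 0, while
  \<open>leaf_geodesic\<close> tests only curves regular on their whole interval.\<close>

lemma regular_curve_shrink:
  assumes "0 < \<epsilon>" "smooth_on {-\<epsilon><..<\<epsilon>} \<gamma>" "velocity \<gamma> 0 \<noteq> 0"
  shows "\<exists>\<delta>>0. \<delta> \<le> \<epsilon> \<and> regular_curve (-\<delta>) \<delta> \<gamma>"
proof -
  have "isCont (velocity \<gamma>) 0"
    using smooth_on_continuous_on[OF smooth_on_velocity[OF _ assms(2)]] assms(1)
    by (simp add: continuous_on_eq_continuous_at)
  from continuous_at_avoid[OF this assms(3)]
  obtain d where d: "d > 0" "\<And>t. dist 0 t < d \<Longrightarrow> velocity \<gamma> t \<noteq> 0" by blast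
  have "regular_curve (- min \<epsilon> d) (min \<epsilon> d) \<gamma>"
    unfolding regular_curve_def
  proof
    show "smooth_on {- min \<epsilon> d<..<min \<epsilon> d} \<gamma>"
      by (rule smooth_on_subset[OF assms(2)]) auto
  qed (use d(2) in auto)
  then show ?thesis using assms(1) d(1) by (intro exI[of _ "min \<epsilon> d"]) auto
qed

text \<open>Turns the set-theoretic web data at \<open>p\<close> into four regular curves in leaves,
  with pairwise independent velocities, on which the geodesic condition can be evaluated.\<close>

lemma planar_4_web_regular_curves:
  assumes W: "planar_4_web D W" and p: "p \<in> D"
  shows "\<exists>\<gamma>. pairwise (\<lambda>F G. cross2 (velocity (\<gamma> F) 0) (velocity (\<gamma> G) 0) \<noteq> 0) W \<and>
    (\<forall>F\<in>W. \<exists>\<epsilon>>0. \<exists>L\<in>F. regular_curve (-\<epsilon>) \<epsilon> (\<gamma> F) \<and> \<gamma> F ` {-\<epsilon><..<\<epsilon>} \<subseteq> L \<and> \<gamma> F 0 = p)"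
proof -
  have fol: "\<And>F. F \<in> W \<Longrightarrow> foliation D F" and tr: "pairwise transversal W" and card: "card W = 4"
    using W unfolding planar_4_web_def by auto
  have "\<exists>L\<in>F. p \<in> L" if "F \<in> W" for F
    using fol[OF that] p unfolding foliation_def partition_on_def by blast
  then obtain leaf where leaf: "\<And>F. F \<in> W \<Longrightarrow> leaf F \<in> F" "\<And>F. F \<in> W \<Longrightarrow> p \<in> leaf F"
    by metis
  have sum: "\<exists>u\<in>leaf_tangent (leaf F) p. \<exists>v\<in>leaf_tangent (leaf G) p. w = u + v"
    if "F \<in> W" "G \<in> W" "F \<noteq> G" for F G w
  proof -
    have "transversal F G" using tr that unfolding pairwise_def by blast
    then have "{u + v | u v. u \<in> leaf_tangent (leaf F) p \<and> v \<in> leaf_tangent (leaf G) p} = UNIV"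
      using leaf that unfolding transversal_def by blast
    then have "w \<in> {u + v | u v. u \<in> leaf_tangent (leaf F) p \<and> v \<in> leaf_tangent (leaf G) p}"
      by simp
    then show ?thesis by blast
  qed
  \<comment> \<open>If \<open>F\<close> had only the zero tangent, every sum with a tangent of
    another foliation \<open>G\<close> would lie in the kernel of a nonzero form.\<close>
  have nonzero: "\<exists>u\<in>leaf_tangent (leaf F) p. u \<noteq> 0" if F: "F \<in> W" for F
  proof (rule ccontr)
    assume 0: "\<not> ?thesis"
    have "W \<noteq> {F}" using card by auto
    then obtain G where G: "G \<in> W" "F \<noteq> G" using F by blast
    obtain l :: "plane \<Rightarrow> real" and w where l: "linear l" "l w \<noteq> 0" "\<forall>v\<in>leaf_tangent (leaf G) p. l v = 0"
      using leaf_tangent_subset_kernel[OF fol[OF G(1)] leaf(1)[OF G(1)] leaf(2)[OF G(1)]]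
      by (elim exE conjE)
    from sum[OF F G, of w] 0 l(3) have "l w = 0" by auto
    with l(2) show False by simp
  qed
  have "\<exists>\<gamma>. velocity \<gamma> 0 \<in> leaf_tangent (leaf F) p \<and> (\<exists>\<epsilon>>0. regular_curve (-\<epsilon>) \<epsilon> \<gamma> \<and>
      \<gamma> ` {-\<epsilon><..<\<epsilon>} \<subseteq> leaf F \<and> \<gamma> 0 = p)" if F: "F \<in> W" for F
  proof -
    obtain \<gamma> \<epsilon> where nz: "velocity \<gamma> 0 \<noteq> 0" and \<gamma>: "0 < \<epsilon>" "smooth_on {-\<epsilon><..<\<epsilon>} \<gamma>"
      "\<gamma> ` {-\<epsilon><..<\<epsilon>} \<subseteq> leaf F" "\<gamma> 0 = p"
      using nonzero[OF F] unfolding leaf_tangent_def by blast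
    obtain \<delta> where "0 < \<delta>" "\<delta> \<le> \<epsilon>" "regular_curve (-\<delta>) \<delta> \<gamma>"
      using regular_curve_shrink[OF \<gamma>(1,2) nz] by blast
    moreover have "\<gamma> ` {-\<delta><..<\<delta>} \<subseteq> leaf F" using \<gamma>(3) \<open>\<delta> \<le> \<epsilon>\<close> by fastforce
    ultimately show ?thesis using leaf_tangent_velocity[OF \<gamma>] \<gamma>(4) by blast
  qed
  then have "\<exists>\<gamma>. \<forall>F\<in>W. velocity (\<gamma> F) 0 \<in> leaf_tangent (leaf F) p \<and> (\<exists>\<epsilon>>0. regular_curve (-\<epsilon>) \<epsilon> (\<gamma> F) \<and>
      \<gamma> F ` {-\<epsilon><..<\<epsilon>} \<subseteq> leaf F \<and> \<gamma> F 0 = p)"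
    by (intro bchoice ballI)
  then obtain \<gamma> where \<gamma>: "\<And>F. F \<in> W \<Longrightarrow> velocity (\<gamma> F) 0 \<in> leaf_tangent (leaf F) p"
    "\<And>F. F \<in> W \<Longrightarrow> \<exists>\<epsilon>>0. regular_curve (-\<epsilon>) \<epsilon> (\<gamma> F) \<and> \<gamma> F ` {-\<epsilon><..<\<epsilon>} \<subseteq> leaf F \<and> \<gamma> F 0 = p"
    by blast
  have nz: "velocity (\<gamma> F) 0 \<noteq> 0" if "F \<in> W" for F
    using \<gamma>(2)[OF that] unfolding regular_curve_def by fastforce
  have "cross2 (velocity (\<gamma> F) 0) (velocity (\<gamma> G) 0) \<noteq> 0" if FG: "F \<in> W" "G \<in> W" "F \<noteq> G" for F G
  proof
    let ?u = "velocity (\<gamma> F) 0" and ?v = "velocity (\<gamma> G) 0"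
    assume 0: "cross2 ?u ?v = 0"
    have par: "cross2 w (velocity (\<gamma> H) 0) = 0" if H: "H \<in> W" and w: "w \<in> leaf_tangent (leaf H) p" for H w
    proof -
      obtain l :: "plane \<Rightarrow> real" and z where l: "linear l" "l z \<noteq> 0" "\<forall>v\<in>leaf_tangent (leaf H) p. l v = 0"
        using leaf_tangent_subset_kernel[OF fol[OF H] leaf(1)[OF H] leaf(2)[OF H]]
        by (elim exE conjE)
      show ?thesis
        by (rule cross2_eq_0_of_kernel[OF l(1,2) l(3)[rule_format, OF w] l(3)[rule_format, OF \<gamma>(1)[OF H]]])
    qed
    obtain c where c: "?u = c *\<^sub>R ?v" using 0 cross2_eq_0_iff[OF nz[OF FG(2)]] by blast
    have "c \<noteq> 0" using c nz[OF FG(1)] by auto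
    \<comment> \<open>Parallel velocities put both tangent sets on the line of \<open>?v\<close>,
      yet their sums fill the plane; so \<open>?v\<close> would be parallel to both axes.\<close>
    have "cross2 w ?v = 0" for w
    proof -
      obtain a b where ab: "a \<in> leaf_tangent (leaf F) p" "b \<in> leaf_tangent (leaf G) p" "w = a + b"
        using sum[OF FG, of w] by blast
      have "c * cross2 a ?v = cross2 a ?u" unfolding c by (simp add: cross2_def algebra_simps)
      then show ?thesis
        using par[OF FG(1) ab(1)] par[OF FG(2) ab(2)] \<open>c \<noteq> 0\<close> by (simp add: ab(3) cross2_add_left)
    qed
    from this[of "axis 1 1"] this[of "axis 2 1"] have "?v = 0"
      by (simp add: cross2_def axis_def vec_eq_iff forall_2)
    with nz[OF FG(2)] show False by simp
  qed
  then have "pairwise (\<lambda>F G. cross2 (velocity (\<gamma> F) 0) (velocity (\<gamma> G) 0) \<noteq> 0) W"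
    by (auto simp: pairwise_def)
  moreover have "\<exists>\<epsilon>>0. \<exists>L\<in>F. regular_curve (-\<epsilon>) \<epsilon> (\<gamma> F) \<and> \<gamma> F ` {-\<epsilon><..<\<epsilon>} \<subseteq> L \<and> \<gamma> F 0 = p"
    if "F \<in> W" for F
    using \<gamma>(2)[OF that] leaf(1)[OF that] by blast
  ultimately show ?thesis by blast
qed

section \<open>Projective classes, geodesic leaves and the main result\<close>

lemma projective_structure_representative:
  assumes "projective_structure D P"
  shows "\<exists>Nab\<in>P. affine_connection D Nab \<and>
    P = {Nab'. affine_connection D Nab' \<and> projectively_equivalent D Nab Nab'}"
proof -
  obtain Nab where Nab: "affine_connection D Nab"
    and P: "P = {Nab'. affine_connection D Nab' \<and> projectively_equivalent D Nab Nab'}"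
    using assms unfolding projective_structure_def quotient_def by auto
  have "projectively_equivalent D Nab Nab"
    unfolding projectively_equivalent_def
    by (intro exI[of _ "\<lambda>_. 0"]) (simp add: smooth_on_const)
  then have "Nab \<in> P" using Nab P by simp
  with Nab P show ?thesis by blast
qed

lemma leaf_geodesic_acceleration:
  assumes "leaf_geodesic P L" "Nab \<in> P" "regular_curve (-\<epsilon>) \<epsilon> \<gamma>" "\<gamma> ` {-\<epsilon><..<\<epsilon>} \<subseteq> L" "0 < \<epsilon>"
  shows "cross2 (acceleration Nab \<gamma> 0) (velocity \<gamma> 0) = 0"
proof -
  have "unparametrized_geodesic Nab (-\<epsilon>) \<epsilon> \<gamma>"
    using assms unfolding leaf_geodesic_def by blast
  then obtain c where "acceleration Nab \<gamma> 0 = c *\<^sub>R velocity \<gamma> 0"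
    using assms(5) unfolding unparametrized_geodesic_def by fastforce
  then show ?thesis by (simp add: cross2_scaleR_left)
qed

text \<open>The second derivatives cancel in the difference of two accelerations along one curve.\<close>

lemma cross2_christoffel_diff:
  assumes "cross2 (acceleration Nab \<gamma> t) (velocity \<gamma> t) = 0" "cross2 (acceleration Nab' \<gamma> t) (velocity \<gamma> t) = 0"
  shows "cross2 (christoffel Nab (\<gamma> t) (velocity \<gamma> t) (velocity \<gamma> t)
    - christoffel Nab' (\<gamma> t) (velocity \<gamma> t) (velocity \<gamma> t)) (velocity \<gamma> t) = 0"
  using assms by (simp add: acceleration_eq cross2_add_left cross2_diff_left)

theorem corollary9:
  fixes D D' :: "plane set"
    and W W' :: "plane set set set"
    and P P' :: "connection set"
    and \<phi> :: "plane \<Rightarrow> plane"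
  assumes "planar_domain D" and "planar_domain D'"
    and "planar_4_web D W" and "planar_4_web D' W'"
    and "web_projective_structure D W P" and "web_projective_structure D' W' P'"
    and "diffeomorphism D D' \<phi>" and "sends_web \<phi> W W'"
  shows "projective_transformation D P D' P' \<phi>"
proof -
  have D: "open D" and D': "open D'" using assms(1,2) unfolding planar_domain_def by auto
  note diffeo = assms(7)
  note sm = diffeo_smooth(1)[OF D D' diffeo]
  have W4: "card W = 4" using assms(3) unfolding planar_4_web_def by blast
  have geo: "\<And>F L. F \<in> W \<Longrightarrow> L \<in> F \<Longrightarrow> leaf_geodesic P L"
    and geo': "\<And>F L. F \<in> W' \<Longrightarrow> L \<in> F \<Longrightarrow> leaf_geodesic P' L"
    using assms(5,6) unfolding web_projective_structure_def by auto
  obtain N where N: "affine_connection D N" "N \<in> P"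
    and P: "P = {Nab. affine_connection D Nab \<and> projectively_equivalent D N Nab}"
    using projective_structure_representative assms(5) unfolding web_projective_structure_def by blast
  obtain N' where N': "affine_connection D' N'" "N' \<in> P'"
    and P': "P' = {Nab. affine_connection D' Nab \<and> projectively_equivalent D' N' Nab}"
    using projective_structure_representative assms(6) unfolding web_projective_structure_def by blast
  have aff': "affine_connection D' Nab" if "Nab \<in> P'" for Nab using that P' by simp
  have linA: "linear (frechet_derivative \<phi> (at p))"
    and linB: "linear (frechet_derivative (inv_into D \<phi>) (at (\<phi> p)))" if "p \<in> D" for p
    using linear_frechet_smooth[OF sm that]
      linear_frechet_smooth[OF diffeo_smooth(2)[OF D D' diffeo] diffeomorphism_inverse(1)[OF diffeo that]] .
  \<comment> \<open>Each of the three facts has its own premise that the point lies in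
    \<open>D\<close>, hence \<open>p p p\<close> in the uses below.\<close>
  note cross_iff = cross2_linear_image_eq_0_iff[OF linA linB
      diffeomorphism_frechet_derivative_inverse(1)[OF diffeo D D']]

  \<comment> \<open>One statement for both inclusions. For a carried pair, membership of the target
    in \<open>P'\<close> lets the source be compared with \<open>N\<close> on \<open>D\<close>, and
    membership of the source in \<open>P\<close> lets the target be compared with \<open>N'\<close>
    on \<open>D'\<close>.\<close>
  have directions: "\<exists>u. pairwise (\<lambda>F G. cross2 (u F) (u G) \<noteq> 0) W \<and> (\<forall>F\<in>W.
      (Nab' \<in> P' \<longrightarrow> cross2 (christoffel N p (u F) (u F) - christoffel Nab p (u F) (u F)) (u F) = 0) \<and>
      (Nab \<in> P \<longrightarrow> cross2 (christoffel N' (\<phi> p) (A (u F)) (A (u F)) - christoffel Nab' (\<phi> p) (A (u F)) (A (u F))) (A (u F)) = 0))"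
    if p: "p \<in> D" and A: "A = frechet_derivative \<phi> (at p)"
      and Nab': "affine_connection D' Nab'" and carries: "carries_connection D D' \<phi> Nab Nab'"
    for p A Nab Nab'
  proof -
    obtain \<gamma> where \<gamma>: "\<forall>F\<in>W. \<exists>\<epsilon>>0. \<exists>L\<in>F. regular_curve (-\<epsilon>) \<epsilon> (\<gamma> F) \<and>
        \<gamma> F ` {-\<epsilon><..<\<epsilon>} \<subseteq> L \<and> \<gamma> F 0 = p"
      and pw: "pairwise (\<lambda>F G. cross2 (velocity (\<gamma> F) 0) (velocity (\<gamma> G) 0) \<noteq> 0) W"
      using planar_4_web_regular_curves[OF assms(3) p] by (elim exE conjE)
    have "(Nab' \<in> P' \<longrightarrow> cross2 (christoffel N p u u - christoffel Nab p u u) u = 0) \<and>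
      (Nab \<in> P \<longrightarrow> cross2 (christoffel N' (\<phi> p) (A u) (A u) - christoffel Nab' (\<phi> p) (A u) (A u)) (A u) = 0)"
      if F: "F \<in> W" and u: "u = velocity (\<gamma> F) 0" for F u
    proof -
      obtain \<epsilon> L where \<epsilon>: "0 < \<epsilon>" and L: "L \<in> F" and reg: "regular_curve (-\<epsilon>) \<epsilon> (\<gamma> F)"
        and im: "\<gamma> F ` {-\<epsilon><..<\<epsilon>} \<subseteq> L" and 0: "\<gamma> F 0 = p"
        using \<gamma> F by blast
      define \<delta> where "\<delta> t = \<phi> (\<gamma> F t)" for t
      let ?I = "{-\<epsilon><..<\<epsilon>}"
      have "partition_on D F"
        using assms(3) F unfolding planar_4_web_def foliation_def by simp
      then have "L \<subseteq> D" using partition_onD1 L by blast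
      then have I: "open ?I" "smooth_on ?I (\<gamma> F)" "0 \<in> ?I" "\<gamma> F ` ?I \<subseteq> D"
        using reg im \<epsilon> unfolding regular_curve_def by auto
      note vel = velocity_compose[OF I(1,2) _ I(4) sm, folded \<delta>_def[abs_def]]
      have vel0: "velocity \<delta> 0 = A u" and \<delta>0: "\<delta> 0 = \<phi> p"
        using vel[OF I(3)] 0 by (simp_all add: A u \<delta>_def)
      have acc0: "acceleration Nab' \<delta> 0 = A (acceleration Nab (\<gamma> F) 0)"
        using carries_connection_acceleration[OF D D' diffeo Nab' carries I] 0
        by (simp add: A \<delta>_def[abs_def])
      \<comment> \<open>The image curve must be regular before geodesicity of the image leaf
        applies; the derivative of \<open>\<phi>\<close> has a left inverse and so kills no nonzero
        velocity.\<close>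
      have "regular_curve (-\<epsilon>) \<epsilon> \<delta>"
        unfolding regular_curve_def
      proof (intro conjI ballI)
        show "smooth_on ?I \<delta>"
          unfolding \<delta>_def[abs_def] by (rule smooth_on_compose[OF I(1,4,2) sm])
        fix t
        assume t: "t \<in> ?I"
        then have tD: "\<gamma> F t \<in> D" using I(4) by blast
        have "velocity (\<gamma> F) t \<noteq> 0" using reg t unfolding regular_curve_def by blast
        then show "velocity \<delta> t \<noteq> 0"
          using diffeomorphism_frechet_derivative_inverse(1)[OF diffeo D D' tD, of "velocity (\<gamma> F) t"]
            linear_0[OF linB[OF tD]] vel[OF t] by force
      qed
      moreover obtain F' where F': "F' \<in> W'" "\<phi> ` L \<in> F'"
        using assms(8) F L unfolding sends_web_def by blast
      moreover have "\<delta> ` ?I \<subseteq> \<phi> ` L" using im by (auto simp: \<delta>_def)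
      ultimately have geodesic': "cross2 (acceleration M \<delta> 0) (velocity \<delta> 0) = 0" if "M \<in> P'" for M
        using leaf_geodesic_acceleration[OF geo'[OF F'] that] \<epsilon> by blast
      have geodesic: "cross2 (acceleration M (\<gamma> F) 0) (velocity (\<gamma> F) 0) = 0" if "M \<in> P" for M
        by (rule leaf_geodesic_acceleration[OF geo[OF F L] that reg im \<epsilon>])
      \<comment> \<open>Acceleration and velocity at 0 are both moved by \<open>A\<close>, so
        parallelism passes in either direction between the leaf and its image.\<close>
      have iff: "cross2 (acceleration Nab' \<delta> 0) (velocity \<delta> 0) = 0
          \<longleftrightarrow> cross2 (acceleration Nab (\<gamma> F) 0) (velocity (\<gamma> F) 0) = 0"
        unfolding acc0 vel0 A u by (rule cross_iff[OF p p p])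
      show ?thesis
        using cross2_christoffel_diff[of N "\<gamma> F" 0 Nab] cross2_christoffel_diff[of N' \<delta> 0 Nab']
          geodesic[OF N(2)] geodesic'[OF N'(2)] geodesic geodesic' iff
        unfolding vel0 \<delta>0 0 u[symmetric] by blast
    qed
    with pw show ?thesis by (intro exI[of _ "\<lambda>F. velocity (\<gamma> F) 0"]) blast
  qed

  have "push_structure D D' \<phi> P \<subseteq> P'"
  proof
    fix Nab'
    assume "Nab' \<in> push_structure D D' \<phi> P"
    then obtain Nab where Nab': "affine_connection D' Nab'" and Nab: "Nab \<in> P"
      and carries: "carries_connection D D' \<phi> Nab Nab'"
      unfolding push_structure_def by blast
    have "projectively_equivalent D' N' Nab'"
    proof (rule projectively_equivalent_of_four_directions[OF D' N'(1) Nab' W4])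
      fix q
      assume "q \<in> D'"
      then obtain p where p: "p \<in> D" and q: "q = \<phi> p"
        using diffeomorphism_inverse(3,4)[OF diffeo] by metis
      define A where "A = frechet_derivative \<phi> (at p)"
      obtain u where u: "pairwise (\<lambda>F G. cross2 (u F) (u G) \<noteq> 0) W"
        "\<forall>F\<in>W. cross2 (christoffel N' q (A (u F)) (A (u F)) - christoffel Nab' q (A (u F)) (A (u F))) (A (u F)) = 0"
        using directions[OF p A_def Nab' carries] Nab unfolding q by blast
      \<comment> \<open>Here the comparison takes place on \<open>D'\<close>, so the four directions
        are the images \<open>A (u F)\<close>, still independent because \<open>A\<close> is
        invertible.\<close>
      have "pairwise (\<lambda>F G. cross2 (A (u F)) (A (u G)) \<noteq> 0) W"
        using u(1) by (simp add: A_def cross_iff[OF p p p])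
      with u(2) show "\<exists>u. pairwise (\<lambda>i j. cross2 (u i) (u j) \<noteq> 0) W \<and>
        (\<forall>i\<in>W. cross2 (christoffel N' q (u i) (u i) - christoffel Nab' q (u i) (u i)) (u i) = 0)"
        by (intro exI[of _ "\<lambda>F. A (u F)"]) blast
    qed
    then show "Nab' \<in> P'" using P' Nab' by simp
  qed
  moreover have "P' \<subseteq> push_structure D D' \<phi> P"
  proof
    fix Nab'
    assume Nab': "Nab' \<in> P'"
    \<comment> \<open>The required source connection: it is carried to \<open>Nab'\<close>, and its
      membership in \<open>P\<close> follows by comparing it with \<open>N\<close> along the leaves
      of \<open>W\<close>.\<close>
    let ?Nab = "pull_connection D \<phi> Nab'"
    note carries = carries_pull_connection[OF D D' diffeo, of Nab']
    have Nab: "affine_connection D ?Nab"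
      by (rule affine_connection_pull_connection[OF D D' diffeo aff'[OF Nab']])
    have "projectively_equivalent D N ?Nab"
      by (rule projectively_equivalent_of_four_directions[OF D N(1) Nab W4])
        (use directions[OF _ refl aff'[OF Nab'] carries] Nab' in blast)
    then have "?Nab \<in> P" using P Nab by simp
    then show "Nab' \<in> push_structure D D' \<phi> P"
      using carries aff'[OF Nab'] unfolding push_structure_def by blast
  qed
  ultimately show ?thesis using diffeo unfolding projective_transformation_def by blast
qed

end
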